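(* Let $n\ge 3$, $\gamma_0,\dots,\gamma_n\in\{1,-1\}$, and $x\in\mathcal E'_{n-1}$. Then the diameters of the subgraphs $C(x)$ and $C(\tilde x)$ of $\Gamma_e(\mathcal A_{n+1})$ are equal to three.
   Context: Cayley–Dickson algebras: $\mathcal A_0=\mathbb R$ with trivial conjugation and basis element $e^{(0)}_0=1$. For $\gamma_k\in\{1,-1\}$, $\mathcal A_{k+1}=\mathcal A_k\{\gamma_k\}$ consists of pairs $(a,b)$ of elements of $\mathcal A_k$ with componentwise linear operations, product $(a,b)(c,d)=(ac+\gamma_k\bar d b,\ da+b\bar c)$ and conjugation $\overline{(a,b)}=(\bar a,-b)$. Write $\mathcal A_n=\mathcal A_n\{\gamma_0,\dots,\gamma_{n-1}\}$ and $\mathcal A_{n+1}=\mathcal A_{n+1}\{\gamma_0,\dots,\gamma_n\}$. The standard basis of $\mathcal A_{k+1}$ is $e^{(k+1)}_j=(e^{(k)}_j,0)$ for $0\le j<2^k$ and $e^{(k+1)}_j=(0,e^{(k)}_{j-2^k})$ for $2^k\le j<2^{k+1}$. $\mathcal E_n$ is the standard basis of $\mathcal A_n$, $e_0$ is the unit, $\mathcal E'_n=\mathcal E_n\setminus\{e_0\}$. Identify $a\in\mathcal A_{n-1}$ with $(a,0)\in\mathcal A_n$, so $\mathcal E_{n-1}\subset\mathcal E_n$. In $\mathcal A_n$ put $\tilde e_0=(0,e_0)=e^{(n)}_{2^{n-1}}$ and $\tilde a=a\tilde e_0$; for $x\in\mathcal E'_{n-1}$ one has $\tilde x\in\mathcal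 E_n$. Two elements $u,v$ of an algebra are orthogonal if $uv=vu=0$. The graph $\Gamma_e(\mathcal A_{n+1})$: vertices are the lines $\mathbb R(a,b)\subset\mathcal A_{n+1}$ spanned by zero divisors $(a,b)$ with $a\in\mathcal E'_n$, $b\in\pm\mathcal E_n$; two distinct lines are adjacent iff their generators are orthogonal. For $y\in\mathcal E_n$, $C(y)$ is the induced subgraph of $\Gamma_e(\mathcal A_{n+1})$ on the vertices $(a,b)$ with $ab=\pm y$. The diameter of a graph is the supremum of distances between its vertices. *)

theory Defs
  imports "Graph_Theory.Graph_Theory"
begin

section \<open>Real Cayley--Dickson algebras\<close>

text \<open>
  The elements of all the algebras A_n live in one type: an element of A_0 is a
  scalar \<open>Sc r\<close>, and an element (a,b) of A_(n+1) is \<open>Db a b\<close> with a, b in A_n.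
  The set \<open>CD n\<close> is the carrier of A_n, that is, the full binary trees of height n.
  The operations are meant only for arguments from a common \<open>CD n\<close>; on arguments
  of different shapes they are unspecified.
\<close>

datatype cd = Sc real | Db cd cd

fun CD :: "nat \<Rightarrow> cd set" where
  "CD 0 = range Sc"
| "CD (Suc n) = {Db a b | a b. a \<in> CD n \<and> b \<in> CD n}"

fun cd_zero :: "nat \<Rightarrow> cd" where
  "cd_zero 0 = Sc 0"
| "cd_zero (Suc n) = Db (cd_zero n) (cd_zero n)"

fun cd_scale :: "real \<Rightarrow> cd \<Rightarrow> cd" where
  "cd_scale c (Sc r) = Sc (c * r)"
| "cd_scale c (Db a b) = Db (cd_scale c a) (cd_scale c b)"

definition cd_neg :: "cd \<Rightarrow> cd" where
  "cd_neg a = cd_scale (-1) a"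

fun cd_add :: "cd \<Rightarrow> cd \<Rightarrow> cd" where
  "cd_add (Sc r) (Sc s) = Sc (r + s)"
| "cd_add (Db a b) (Db c d) = Db (cd_add a c) (cd_add b d)"

fun cd_conj :: "cd \<Rightarrow> cd" where
  "cd_conj (Sc r) = Sc r"
| "cd_conj (Db a b) = Db (cd_conj a) (cd_neg b)"

text \<open>\<open>cd_mult \<gamma> n\<close> is the product of A_n; it uses only the parameters \<open>\<gamma> 0, \<dots>, \<gamma> (n - 1)\<close>.\<close>

fun cd_mult :: "(nat \<Rightarrow> real) \<Rightarrow> nat \<Rightarrow> cd \<Rightarrow> cd \<Rightarrow> cd" where
  "cd_mult \<gamma> 0 (Sc r) (Sc s) = Sc (r * s)"
| "cd_mult \<gamma> (Suc k) (Db a b) (Db c d) =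
     Db (cd_add (cd_mult \<gamma> k a c) (cd_scale (\<gamma> k) (cd_mult \<gamma> k (cd_conj d) b)))
        (cd_add (cd_mult \<gamma> k d a) (cd_mult \<gamma> k b (cd_conj c)))"

fun cd_e :: "nat \<Rightarrow> nat \<Rightarrow> cd" where
  "cd_e 0 j = Sc 1"
| "cd_e (Suc k) j =
     (if j < 2 ^ k then Db (cd_e k j) (cd_zero k) else Db (cd_zero k) (cd_e k (j - 2 ^ k)))"

definition cd_basis :: "nat \<Rightarrow> cd set" where
  "cd_basis n = cd_e n ` {..<2 ^ n}"

definition cd_basis' :: "nat \<Rightarrow> cd set" where
  "cd_basis' n = cd_basis n - {cd_e n 0}"

text \<open>The identification of a in A_k with (a,0) in A_(k+1).\<close>

definition cd_embed :: "nat \<Rightarrow> cd \<Rightarrow> cd" where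
  "cd_embed k a = Db a (cd_zero k)"

text \<open>For a in A_n with n > 0; here \<open>cd_e n (2 ^ (n - 1))\<close> is (0,e_0).\<close>

definition cd_tilde :: "(nat \<Rightarrow> real) \<Rightarrow> nat \<Rightarrow> cd \<Rightarrow> cd" where
  "cd_tilde \<gamma> n a = cd_mult \<gamma> n a (cd_e n (2 ^ (n - 1)))"

definition cd_zero_divisor :: "(nat \<Rightarrow> real) \<Rightarrow> nat \<Rightarrow> cd \<Rightarrow> bool" where
  "cd_zero_divisor \<gamma> n u \<longleftrightarrow> u \<in> CD n \<and> u \<noteq> cd_zero n \<and>
     (\<exists>v \<in> CD n. v \<noteq> cd_zero n \<and> (cd_mult \<gamma> n u v = cd_zero n \<or> cd_mult \<gamma> n v u = cd_zero n))"

definition cd_orthogonal :: "(nat \<Rightarrow> real) \<Rightarrow> nat \<Rightarrow> cd \<Rightarrow> cd \<Rightarrow> bool" where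
  "cd_orthogonal \<gamma> n u v \<longleftrightarrow> cd_mult \<gamma> n u v = cd_zero n \<and> cd_mult \<gamma> n v u = cd_zero n"

definition cd_line :: "cd \<Rightarrow> cd set" where
  "cd_line u = range (\<lambda>c. cd_scale c u)"


section \<open>The graphs\<close>

text \<open>The undirected graphs are represented as symmetric loop-free digraphs. All objects
  below carry the index n of A_n although they are formed from elements of A_(n+1).\<close>

definition Gamma_e_gens :: "(nat \<Rightarrow> real) \<Rightarrow> nat \<Rightarrow> (cd \<times> cd) set" where
  "Gamma_e_gens \<gamma> n = {(a, b). a \<in> cd_basis' n \<and> b \<in> cd_basis n \<union> cd_neg ` cd_basis n \<and>
     cd_zero_divisor \<gamma> (Suc n) (Db a b)}"

definition Gamma_e :: "(nat \<Rightarrow> real) \<Rightarrow> nat \<Rightarrow> cd set pair_pre_digraph" where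
  "Gamma_e \<gamma> n =
     \<lparr> pverts = {cd_line (Db a b) | a b. (a, b) \<in> Gamma_e_gens \<gamma> n},
       parcs = {(cd_line (Db a b), cd_line (Db c d)) | a b c d.
          (a, b) \<in> Gamma_e_gens \<gamma> n \<and> (c, d) \<in> Gamma_e_gens \<gamma> n \<and>
          cd_line (Db a b) \<noteq> cd_line (Db c d) \<and>
          cd_orthogonal \<gamma> (Suc n) (Db a b) (Db c d)} \<rparr>"

lemma pair_bidirected_digraph_Gamma_e: "pair_bidirected_digraph (Gamma_e \<gamma> n)"
proof
  show "symmetric (with_proj (Gamma_e \<gamma> n))"
    unfolding symmetric_def by (rule symI) (auto simp: Gamma_e_def cd_orthogonal_def; metis)
qed (auto simp: Gamma_e_def)

definition C_graph :: "(nat \<Rightarrow> real) \<Rightarrow> nat \<Rightarrow> cd \<Rightarrow> (cd set, cd set \<times> cd set) pre_digraph" where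
  "C_graph \<gamma> n y = with_proj (Gamma_e \<gamma> n) \<restriction>
     {cd_line (Db a b) | a b. (a, b) \<in> Gamma_e_gens \<gamma> n \<and> cd_mult \<gamma> n a b \<in> {y, cd_neg y}}"

text \<open>With unit weights, \<open>wf_digraph.\<mu>\<close> is the usual distance, which is \<open>\<infinity>\<close> between
  vertices not joined by a walk.\<close>

definition graph_diameter :: "('a, 'b) pre_digraph \<Rightarrow> ereal" where
  "graph_diameter G = (SUP u \<in> verts G. SUP v \<in> verts G. wf_digraph.\<mu> G (\<lambda>_. 1) u v)"

lemma wf_digraph_C_graph: "wf_digraph (C_graph \<gamma> n y)"
proof -
  interpret pair_bidirected_digraph "Gamma_e \<gamma> n" by (rule pair_bidirected_digraph_Gamma_e)
  show ?thesis unfolding C_graph_def by (rule wellformed_induce_subgraph)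
qed

end

theory Submission
  imports Defs
begin

text \<open>
  Up to sign, the standard basis elements anticommute and are alternative, so a vertex of
  \<open>C(y)\<close> has the form \<open>(c, \<plusminus>cy)\<close> with \<open>c\<close> an imaginary basis element. The vertices split into
  classes \<open>S\<^sub>+, S\<^sub>-, T\<^sub>+, T\<^sub>-\<close> such that every vertex of \<open>S\<^sub>\<plusminus>\<close> is adjacent to all of \<open>T\<^sub>\<plusminus>\<close>
  and to some vertex of the opposite class of \<open>S\<close>; hence the diameter is at most three.

  If \<open>y\<^sup>2 = -\<gamma>\<^sub>n\<close>, then \<open>T\<^sub>\<plusminus>\<close> consists of \<open>(y, \<plusminus>y\<^sup>2)\<close>, and \<open>(c, \<plusminus>cy)\<close> is adjacent to
  \<open>(cy, \<mp>(cy)y)\<close>. If \<open>y\<^sup>2 = \<gamma>\<^sub>n\<close>, then \<open>(y, \<plusminus>1)\<close> is no zero divisor, and \<open>T\<close> consists of the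
  vertices with a component \<open>\<plusminus>t\<close>, where \<open>t = (0, e\<^sub>0)\<close>; the remaining vertices are paired by
  \<open>c \<leftrightarrow> \<plusminus>ct\<close>.

  The bound is attained because \<open>(a, b)\<close> and \<open>(a, -b)\<close> are neither adjacent nor have a common
  neighbour: it would annihilate their sum \<open>(2a, 0)\<close>.
\<close>

section \<open>Distances in graphs with unit weights\<close>

context wf_digraph
begin

lemma awalk_cost_unit: "awalk_cost (\<lambda>_. 1) p = real (length p)"
  by (induction p) auto

lemma dominates_awalk:
  assumes "u \<rightarrow>\<^bsub>G\<^esub> w" "awalk w p v"
  shows "\<exists>q. awalk u q v \<and> length q = Suc (length p)"
proof -
  obtain e where "e \<in> arcs G" "tail G e = u" "head G e = w"
    using assms(1) by (auto simp: arcs_ends_def arc_to_ends_def)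
  then show ?thesis
    using assms(2) by (intro exI[of _ "e # p"]) (auto simp: awalk_Cons_iff)
qed

lemma unit_distance_le:
  assumes "awalk u p v" "length p \<le> k"
  shows "\<mu> (\<lambda>_. 1) u v \<le> ereal (real k)"
proof -
  have "\<mu> (\<lambda>_. 1) u v \<le> ereal (real (length p))"
    using min_cost_le_walk_cost[OF assms(1), of "\<lambda>_. 1"] by (simp add: awalk_cost_unit)
  also have "\<dots> \<le> ereal (real k)" using assms(2) by simp
  finally show ?thesis .
qed

text \<open>The distance is an infimum over walks, so it suffices to exclude walks with zero, one or
  two arcs. Pairs joined by no walk are covered too, since the empty infimum is
  \<open>\<infinity>\<close>.\<close>

lemma unit_distance_ge_3:
  assumes "u \<noteq> v" "\<not> u \<rightarrow>\<^bsub>G\<^esub> v" "\<And>w. \<not> (u \<rightarrow>\<^bsub>G\<^esub> w \<and> w \<rightarrow>\<^bsub>G\<^esub> v)"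
  shows "\<mu> (\<lambda>_. 1) u v \<ge> 3"
  unfolding \<mu>_def
proof (rule INF_greatest, clarsimp simp: awalk_cost_unit)
  fix p assume p: "awalk u p v"
  have "length p \<ge> 3"
  proof (cases p)
    case Nil
    then show ?thesis using p assms(1) by (simp add: awalk_Nil_iff)
  next
    case e: (Cons e q)
    have eu: "u \<rightarrow>\<^bsub>G\<^esub> head G e" and q: "awalk (head G e) q v"
      using p e by (auto simp: awalk_Cons_iff intro: in_arcs_imp_in_arcs_ends)
    show ?thesis
    proof (cases q)
      case Nil
      then show ?thesis using q eu assms(2) by (simp add: awalk_Nil_iff)
    next
      case f: (Cons f r)
      have "head G e \<rightarrow>\<^bsub>G\<^esub> head G f" "awalk (head G f) r v"
        using q f by (auto simp: awalk_Cons_iff intro: in_arcs_imp_in_arcs_ends)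
      then have "r \<noteq> []" using eu assms(3) by (auto simp: awalk_Nil_iff)
      then show ?thesis using e f by (cases r) auto
    qed
  qed
  then show "3 \<le> length p" .
qed

end

text \<open>The longest routes are those from \<open>T i\<close> to \<open>T (\<not> i)\<close>,
  through some vertex of \<open>S i\<close> and its neighbour in \<open>S (\<not> i)\<close>, and
  those from \<open>S i\<close> to \<open>S (\<not> i)\<close>, through the neighbour of the start
  and any vertex of \<open>T (\<not> i)\<close>. Every other pair needs at most two arcs. The pair
  in \<open>far\<close> shows that three is attained.\<close>

lemma graph_diameter_eq_3:
  fixes G :: "('a, 'b) pre_digraph" and S T :: "bool \<Rightarrow> 'a set"
  assumes "wf_digraph G"
    and cover: "verts G \<subseteq> (\<Union>i. S i \<union> T i)"
    and ST: "\<And>i s t. s \<in> S i \<Longrightarrow> t \<in> T i \<Longrightarrow> s \<rightarrow>\<^bsub>G\<^esub> t \<and> t \<rightarrow>\<^bsub>G\<^esub> s"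
    and swap: "\<And>i s. s \<in> S i \<Longrightarrow> \<exists>s' \<in> S (\<not> i). s \<rightarrow>\<^bsub>G\<^esub> s' \<and> s' \<rightarrow>\<^bsub>G\<^esub> s"
    and ne: "\<And>i. S i \<noteq> {}" "\<And>i. T i \<noteq> {}"
    and far: "u \<in> T k" "v \<in> T l" "u \<noteq> v" "\<not> u \<rightarrow>\<^bsub>G\<^esub> v" "\<And>w. \<not> (u \<rightarrow>\<^bsub>G\<^esub> w \<and> w \<rightarrow>\<^bsub>G\<^esub> v)"
  shows "graph_diameter G = 3"
proof -
  interpret wf_digraph G by fact
  define R where "R k u v \<longleftrightarrow> (\<exists>p. awalk u p v \<and> length p \<le> k)" for k :: nat and u v
  have R0: "R k w w" if "w \<in> verts G" for w k
    using that by (auto simp: R_def awalk_Nil_iff intro!: exI[of _ "[]"])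
  have RS: "R (Suc k) a b" if "a \<rightarrow>\<^bsub>G\<^esub> c" "R k c b" for a b c k
    using that dominates_awalk unfolding R_def by (metis Suc_le_mono)
  have R1: "R 3 a b" if "a \<rightarrow>\<^bsub>G\<^esub> b" "b \<in> verts G" for a b
    unfolding numeral_3_eq_3 using that RS R0 by blast
  have R2: "R 3 a b" if "a \<rightarrow>\<^bsub>G\<^esub> c" "c \<rightarrow>\<^bsub>G\<^esub> b" "b \<in> verts G" for a b c
    unfolding numeral_3_eq_3 using that RS R0 by blast
  have R3: "R 3 a b" if "a \<rightarrow>\<^bsub>G\<^esub> c" "c \<rightarrow>\<^bsub>G\<^esub> d" "d \<rightarrow>\<^bsub>G\<^esub> b" "b \<in> verts G" for a b c d
    unfolding numeral_3_eq_3 using that RS R0 by blast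
  have near: "R 3 a b" if "a \<in> verts G" "b \<in> verts G" for a b
  proof -
    consider (SS) i where "a \<in> S i" "b \<in> S i" | (SS') i where "a \<in> S i" "b \<in> S (\<not> i)"
      | (ST) i where "a \<in> S i" "b \<in> T i" | (ST') i where "a \<in> S i" "b \<in> T (\<not> i)"
      | (TS) i where "a \<in> T i" "b \<in> S i" | (TS') i where "a \<in> T i" "b \<in> S (\<not> i)"
      | (TT) i where "a \<in> T i" "b \<in> T i" | (TT') i where "a \<in> T i" "b \<in> T (\<not> i)"
      using subsetD[OF cover \<open>a \<in> verts G\<close>] subsetD[OF cover \<open>b \<in> verts G\<close>]
      by (smt (verit) UN_E UnE)
    then show ?thesis
    proof cases
      case (SS i)
      obtain t where "t \<in> T i" using ne by blast
      then show ?thesis using SS ST R2 that by meson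
    next
      case (SS' i)
      obtain s where s: "s \<in> S (\<not> i)" "a \<rightarrow>\<^bsub>G\<^esub> s" using swap SS' by blast
      obtain t where "t \<in> T (\<not> i)" using ne by blast
      then show ?thesis using SS' s ST R3 that by meson
    next
      case (ST i)
      then show ?thesis using assms(3) R1 that by meson
    next
      case (ST' i)
      obtain s where "s \<in> S (\<not> i)" "a \<rightarrow>\<^bsub>G\<^esub> s" using swap ST' by blast
      then show ?thesis using ST' ST R2 that by meson
    next
      case (TS i)
      then show ?thesis using ST R1 that by meson
    next
      case (TS' i)
      obtain s where "s \<in> S i" "s \<rightarrow>\<^bsub>G\<^esub> b" using swap[of b "\<not> i"] TS' by auto
      then show ?thesis using TS' ST R2 that by meson
    next
      case (TT i)
      obtain s where "s \<in> S i" using ne by blast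
      then show ?thesis using TT ST R2 that by meson
    next
      case (TT' i)
      obtain s where s: "s \<in> S i" using ne by blast
      obtain s' where "s' \<in> S (\<not> i)" "s \<rightarrow>\<^bsub>G\<^esub> s'" using swap s by blast
      then show ?thesis using TT' s ST R3 that by meson
    qed
  qed
  have "\<mu> (\<lambda>_. 1) a b \<le> 3" if "a \<in> verts G" "b \<in> verts G" for a b
    using near[OF that] unit_distance_le[of a _ b 3] unfolding R_def by auto
  then have "graph_diameter G \<le> 3" unfolding graph_diameter_def by (simp add: SUP_least)
  \<comment> \<open>Each vertex of \<open>T i\<close> is an endpoint of an arc because
    \<open>S i\<close> is nonempty.\<close>
  moreover have in_verts: "T i \<subseteq> verts G" for i
    using ST[of _ i] ne(1)[of i] adj_in_verts(1) by (meson all_not_in_conv subsetI)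
  have "3 \<le> graph_diameter G"
    unfolding graph_diameter_def
    using far in_verts by (intro SUP_upper2[of u] SUP_upper2[of v] unit_distance_ge_3) auto
  ultimately show ?thesis by (rule antisym)
qed

section \<open>The algebras and their signed bases\<close>

lemma cd_zero_CD [simp]: "cd_zero n \<in> CD n"
  by (induction n) auto

lemma cd_scale_CD [simp]: "a \<in> CD n \<Longrightarrow> cd_scale c a \<in> CD n"
  by (induction n arbitrary: a) auto

lemma cd_add_CD [simp]: "a \<in> CD n \<Longrightarrow> b \<in> CD n \<Longrightarrow> cd_add a b \<in> CD n"
  by (induction n arbitrary: a b) auto

lemma cd_conj_CD [simp]: "a \<in> CD n \<Longrightarrow> cd_conj a \<in> CD n"
  by (induction n arbitrary: a) (auto simp: cd_neg_def)

lemma cd_mult_CD [simp]: "a \<in> CD n \<Longrightarrow> b \<in> CD n \<Longrightarrow> cd_mult \<gamma> n a b \<in> CD n"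
  by (induction n arbitrary: a b) auto

lemma cd_scale_scale [simp]: "cd_scale c (cd_scale d a) = cd_scale (c * d) a"
  by (induction a) auto

lemma cd_scale_one [simp]: "cd_scale 1 a = a"
  by (induction a) auto

lemma cd_scale_zero [simp]: "cd_scale c (cd_zero n) = cd_zero n"
  by (induction n) auto

lemma cd_scale_0: "a \<in> CD n \<Longrightarrow> cd_scale 0 a = cd_zero n"
  by (induction n arbitrary: a) auto

lemma cd_add_comm: "a \<in> CD n \<Longrightarrow> b \<in> CD n \<Longrightarrow> cd_add a b = cd_add b a"
  by (induction n arbitrary: a b) auto

lemma cd_add_assoc:
  "a \<in> CD n \<Longrightarrow> b \<in> CD n \<Longrightarrow> c \<in> CD n \<Longrightarrow> cd_add (cd_add a b) c = cd_add a (cd_add b c)"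
  by (induction n arbitrary: a b c) fastforce+

lemma cd_add_left_comm:
  "a \<in> CD n \<Longrightarrow> b \<in> CD n \<Longrightarrow> c \<in> CD n \<Longrightarrow> cd_add a (cd_add b c) = cd_add b (cd_add a c)"
  by (metis cd_add_assoc cd_add_comm)

lemma cd_add_zero [simp]:
  "a \<in> CD n \<Longrightarrow> cd_add a (cd_zero n) = a"
  "a \<in> CD n \<Longrightarrow> cd_add (cd_zero n) a = a"
  by (induction n arbitrary: a) auto

lemma cd_scale_add: "a \<in> CD n \<Longrightarrow> b \<in> CD n \<Longrightarrow>
    cd_scale c (cd_add a b) = cd_add (cd_scale c a) (cd_scale c b)"
  by (induction n arbitrary: a b) (auto simp: algebra_simps)

lemma cd_add_scale: "cd_add (cd_scale c a) (cd_scale d a) = cd_scale (c + d) a"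
  by (induction a) (auto simp: algebra_simps)

lemma cd_conj_scale [simp]: "cd_conj (cd_scale c a) = cd_scale c (cd_conj a)"
  by (induction a) (auto simp: cd_neg_def)

lemma cd_conj_conj [simp]: "cd_conj (cd_conj a) = a"
  by (induction a) (auto simp: cd_neg_def)

lemma cd_conj_zero [simp]: "cd_conj (cd_zero n) = cd_zero n"
  by (induction n) (auto simp: cd_neg_def)

lemma cd_conj_add:
  "a \<in> CD n \<Longrightarrow> b \<in> CD n \<Longrightarrow> cd_conj (cd_add a b) = cd_add (cd_conj a) (cd_conj b)"
  by (induction n arbitrary: a b) (auto simp: cd_neg_def cd_scale_add)

lemma cd_mult_scale [simp]:
  "a \<in> CD n \<Longrightarrow> b \<in> CD n \<Longrightarrow> cd_mult \<gamma> n (cd_scale c a) b = cd_scale c (cd_mult \<gamma> n a b)"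
  "a \<in> CD n \<Longrightarrow> b \<in> CD n \<Longrightarrow> cd_mult \<gamma> n a (cd_scale c b) = cd_scale c (cd_mult \<gamma> n a b)"
proof (induction n arbitrary: a b)
  case (Suc n)
  { case 1 with Suc show ?case by (auto simp: cd_scale_add[of _ n] mult.commute) }
  { case 2 with Suc show ?case by (auto simp: cd_scale_add[of _ n] mult.commute) }
qed auto

lemma cd_mult_zero [simp]:
  "a \<in> CD n \<Longrightarrow> cd_mult \<gamma> n (cd_zero n) a = cd_zero n"
  "a \<in> CD n \<Longrightarrow> cd_mult \<gamma> n a (cd_zero n) = cd_zero n"
  by (induction n arbitrary: a) auto

lemma cd_mult_add:
  "a \<in> CD n \<Longrightarrow> b \<in> CD n \<Longrightarrow> c \<in> CD n \<Longrightarrow>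
    cd_mult \<gamma> n a (cd_add b c) = cd_add (cd_mult \<gamma> n a b) (cd_mult \<gamma> n a c)"
  "a \<in> CD n \<Longrightarrow> b \<in> CD n \<Longrightarrow> c \<in> CD n \<Longrightarrow>
    cd_mult \<gamma> n (cd_add b c) a = cd_add (cd_mult \<gamma> n b a) (cd_mult \<gamma> n c a)"
proof (induction n arbitrary: a b c)
  case (Suc n)
  note linear = cd_conj_add[of _ n] cd_scale_add[of _ n] cd_add_assoc[of _ n]
    cd_add_left_comm[of _ n]
  { case 1 with Suc show ?case by (auto simp: linear) }
  { case 2 with Suc show ?case by (auto simp: linear) }
qed (auto simp: algebra_simps)

text \<open>Conjugation is an antiautomorphism although the product is not associative. It turns
  left multiplication into right multiplication, and this later yields anticommutativity of
  imaginary basis elements.\<close>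

lemma cd_conj_mult: "a \<in> CD n \<Longrightarrow> b \<in> CD n \<Longrightarrow>
    cd_conj (cd_mult \<gamma> n a b) = cd_mult \<gamma> n (cd_conj b) (cd_conj a)"
proof (induction n arbitrary: a b)
  case (Suc n)
  then show ?case
    by (auto simp: cd_neg_def cd_conj_add[of _ n] cd_scale_add[of _ n] cd_add_comm[of _ n])
qed auto

section \<open>The unit and the signed standard basis\<close>

lemma cd_e_CD [simp]: "cd_e n j \<in> CD n"
  by (induction n arbitrary: j) auto

lemma cd_conj_one [simp]: "cd_conj (cd_e n 0) = cd_e n 0"
  by (induction n) (auto simp: cd_neg_def)

lemma cd_mult_one [simp]:
  "a \<in> CD n \<Longrightarrow> cd_mult \<gamma> n (cd_e n 0) a = a"
  "a \<in> CD n \<Longrightarrow> cd_mult \<gamma> n a (cd_e n 0) = a"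
  by (induction n arbitrary: a) auto

lemma cd_e_neq_zero: "cd_e n j \<noteq> cd_zero n"
  by (induction n arbitrary: j) auto

text \<open>Including the negatives makes the set closed under conjugation and, for parameters of
  absolute value one, under products. Below, a sign is a real \<open>c\<close> with
  \<open>\<bar>c\<bar> = 1\<close>, so that signs compose by multiplication inside
  \<open>cd_scale\<close>.\<close>

definition signed_basis :: "nat \<Rightarrow> cd set" where
  "signed_basis n = cd_basis n \<union> cd_neg ` cd_basis n"

lemma cd_basis_0: "cd_basis 0 = {Sc 1}"
  by (auto simp: cd_basis_def)

lemma cd_basis_Suc:
  "cd_basis (Suc n) = (\<lambda>u. Db u (cd_zero n)) ` cd_basis n \<union> Db (cd_zero n) ` cd_basis n"
proof -
  have "{..<(2::nat) ^ Suc n} = {..<2 ^ n} \<union> (+) (2 ^ n) ` {..<2 ^ n}"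
    by (auto simp: lessThan_atLeast0)
  then show ?thesis
    unfolding cd_basis_def
    by (simp only: image_Un image_image) (intro arg_cong2[where f = "(\<union>)"] image_cong; simp)
qed

lemma signed_basis_0: "signed_basis 0 = {Sc 1, Sc (-1)}"
  by (auto simp: signed_basis_def cd_basis_0 cd_neg_def)

lemma signed_basis_Suc: "signed_basis (Suc n) =
    (\<lambda>u. Db u (cd_zero n)) ` signed_basis n \<union> Db (cd_zero n) ` signed_basis n"
  by (simp add: signed_basis_def cd_basis_Suc cd_neg_def image_Un image_image Un_ac)

lemma signed_basis_Suc_iff: "Db a b \<in> signed_basis (Suc n) \<longleftrightarrow>
    a \<in> signed_basis n \<and> b = cd_zero n \<or> a = cd_zero n \<and> b \<in> signed_basis n"
  by (auto simp: signed_basis_Suc)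

lemma cd_basis_subset_CD: "cd_basis n \<subseteq> CD n"
  by (auto simp: cd_basis_def)

lemma signed_basis_CD [simp]: "u \<in> signed_basis n \<Longrightarrow> u \<in> CD n"
  using cd_basis_subset_CD[of n] by (auto simp: signed_basis_def cd_neg_def)

lemma zero_not_signed_basis: "u \<in> signed_basis n \<Longrightarrow> u \<noteq> cd_zero n"
  by (induction n arbitrary: u) (auto simp: signed_basis_0 signed_basis_Suc)

lemma one_signed_basis [simp]: "cd_e n 0 \<in> signed_basis n"
  by (auto simp: signed_basis_def cd_basis_def)

lemma signed_basis_scale:
  "u \<in> signed_basis n \<Longrightarrow> \<bar>c\<bar> = 1 \<Longrightarrow> cd_scale c u \<in> signed_basis n"
  by (auto simp: signed_basis_def cd_neg_def abs_eq_iff')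

lemma signed_basis_cases:
  assumes "u \<in> signed_basis n"
  obtains c v where "\<bar>c\<bar> = 1" "v \<in> cd_basis n" "u = cd_scale c v"
  using assms that[of 1] that[of "-1"] by (auto simp: signed_basis_def cd_neg_def)

lemma signed_basis_scale_eq:
  "u \<in> signed_basis n \<Longrightarrow> cd_scale c u = cd_scale d u \<longleftrightarrow> c = d"
  by (induction n arbitrary: u) (auto simp: signed_basis_0 signed_basis_Suc)

lemma signed_basis_scale_eq_zero:
  "u \<in> signed_basis n \<Longrightarrow> cd_scale c u = cd_zero n \<longleftrightarrow> c = 0"
  using signed_basis_scale_eq[of u n c 0] by (simp add: cd_scale_0[of u n])

text \<open>Used to tell lines apart. Elements from different halves could only have proportional
  images if both coefficients vanished; elements of the same half are compared in the smaller
  algebra.\<close>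

lemma cd_basis_scale_eq:
  "u \<in> cd_basis n \<Longrightarrow> v \<in> cd_basis n \<Longrightarrow> cd_scale c u = cd_scale d v \<Longrightarrow> c \<noteq> 0 \<Longrightarrow> u = v \<and> c = d"
proof (induction n arbitrary: u v)
  case (Suc n)
  have "cd_scale e w = cd_zero n \<longleftrightarrow> e = 0" "cd_zero n = cd_scale e w \<longleftrightarrow> e = 0"
    if "w \<in> cd_basis n" for w e
    using signed_basis_scale_eq_zero[of w n e] that by (auto simp: signed_basis_def)
  with Suc show ?case
    by (auto simp: cd_basis_Suc)
qed (auto simp: cd_basis_0)

lemma signed_basis_conj:
  "u \<in> signed_basis n \<Longrightarrow> u \<noteq> cd_e n 0 \<Longrightarrow> u \<noteq> cd_neg (cd_e n 0) \<Longrightarrow> cd_conj u = cd_neg u"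
proof (induction n arbitrary: u)
  case (Suc n)
  then obtain w where "w \<in> signed_basis n" "u = Db w (cd_zero n) \<or> u = Db (cd_zero n) w"
    by (auto simp: signed_basis_Suc)
  with Suc show ?case by (cases "w = cd_e n 0 \<or> w = cd_neg (cd_e n 0)") (auto simp: cd_neg_def)
qed (auto simp: signed_basis_0 cd_neg_def)

lemma signed_basis_conj_cases:
  assumes "u \<in> signed_basis n"
  obtains c where "\<bar>c\<bar> = 1" "cd_conj u = cd_scale c u"
  using that[of 1] that[of "-1"] signed_basis_conj[OF assms]
  by (metis abs_minus_cancel abs_one cd_conj_one cd_conj_scale cd_neg_def cd_scale_one)

lemma signed_basis_conj_mem [simp]: "u \<in> signed_basis n \<Longrightarrow> cd_conj u \<in> signed_basis n"
  by (metis signed_basis_conj_cases signed_basis_scale)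

section \<open>Products of basis elements\<close>

definition sign_params :: "(nat \<Rightarrow> real) \<Rightarrow> nat \<Rightarrow> bool" where
  "sign_params \<gamma> n \<longleftrightarrow> (\<forall>k<n. \<bar>\<gamma> k\<bar> = 1)"

lemma sign_params_Suc: "sign_params \<gamma> (Suc n) \<longleftrightarrow> sign_params \<gamma> n \<and> \<bar>\<gamma> n\<bar> = 1"
  by (auto simp: sign_params_def less_Suc_eq)

lemma signed_basis_mult:
  "sign_params \<gamma> n \<Longrightarrow> u \<in> signed_basis n \<Longrightarrow> v \<in> signed_basis n \<Longrightarrow>
    cd_mult \<gamma> n u v \<in> signed_basis n"
  by (induction n arbitrary: u v)
    (auto simp: signed_basis_0 signed_basis_Suc sign_params_Suc signed_basis_scale)

text \<open>Basis elements are alternative although the algebra is not.\<close>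

lemma signed_basis_alternative:
  assumes "sign_params \<gamma> n" "u \<in> signed_basis n"
  shows "\<exists>c. \<bar>c\<bar> = 1 \<and> cd_mult \<gamma> n u u = cd_scale c (cd_e n 0) \<and>
    (\<forall>z \<in> CD n. cd_mult \<gamma> n u (cd_mult \<gamma> n u z) = cd_scale c z \<and>
       cd_mult \<gamma> n (cd_mult \<gamma> n z u) u = cd_scale c z)"
  using assms
\<comment> \<open>Left and right alternativity go through the induction together: left
  multiplication by \<open>(w, 0)\<close> acts as left multiplication by \<open>w\<close> on the
  first half and as right multiplication by \<open>w\<close> on the second.\<close>
proof (induction n arbitrary: u)
  case 0
  then show ?case by (auto simp: signed_basis_0 intro!: exI[of _ 1])
next
  case (Suc n)
  from Suc.prems have sp: "sign_params \<gamma> n" "\<bar>\<gamma> n\<bar> = 1" by (auto simp: sign_params_Suc)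
  obtain w where w: "w \<in> signed_basis n" "u = Db w (cd_zero n) \<or> u = Db (cd_zero n) w"
    using Suc.prems by (auto simp: signed_basis_Suc)
  obtain c where c: "\<bar>c\<bar> = 1" "cd_mult \<gamma> n w w = cd_scale c (cd_e n 0)"
    "\<And>z. z \<in> CD n \<Longrightarrow> cd_mult \<gamma> n w (cd_mult \<gamma> n w z) = cd_scale c z"
    "\<And>z. z \<in> CD n \<Longrightarrow> cd_mult \<gamma> n (cd_mult \<gamma> n z w) w = cd_scale c z"
    using Suc.IH[OF sp(1) w(1)] by blast
  obtain d where d: "\<bar>d\<bar> = 1" "cd_conj w = cd_scale d w"
    using signed_basis_conj_cases[OF w(1)] by blast
  have dd: "d * d = 1" "d * (d * e) = e" "d * (e * d) = e" for e
    using d(1) by (auto simp: abs_eq_iff')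
  from w(2) show ?case
  proof
    assume u: "u = Db w (cd_zero n)"
    show ?thesis
      by (rule exI[of _ c]) (use w(1) c d in \<open>auto simp: u cd_neg_def mult.assoc dd\<close>)
  next
    assume u: "u = Db (cd_zero n) w"
    show ?thesis
      \<comment> \<open>The witness is the square of \<open>(0, w)\<close>, namely
        \<open>\<gamma> n\<close> times \<open>cd_conj w\<close> times \<open>w\<close>, where
        \<open>cd_conj w\<close> is \<open>d\<close> times \<open>w\<close> and the square of
        \<open>w\<close> is \<open>c\<close>.\<close>
      by (rule exI[of _ "\<gamma> n * d * c"])
        (use w(1) c d sp(2) in \<open>auto simp: u cd_neg_def abs_mult cd_conj_mult mult_ac dd\<close>)
  qed
qed

lemma signed_basis_square:
  assumes "sign_params \<gamma> n" "u \<in> signed_basis n"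
  obtains c where "\<bar>c\<bar> = 1" "cd_mult \<gamma> n u u = cd_scale c (cd_e n 0)"
  using signed_basis_alternative[OF assms] by blast

lemma signed_basis_alt:
  assumes "sign_params \<gamma> n" "u \<in> signed_basis n" "cd_mult \<gamma> n u u = cd_scale c (cd_e n 0)"
    and "z \<in> CD n"
  shows "cd_mult \<gamma> n u (cd_mult \<gamma> n u z) = cd_scale c z"
    and "cd_mult \<gamma> n (cd_mult \<gamma> n z u) u = cd_scale c z"
    and "\<bar>c\<bar> = 1"
  using signed_basis_alternative[OF assms(1,2)] assms(3,4)
  by (auto simp: signed_basis_scale_eq[OF one_signed_basis])

section \<open>Imaginary units and their quaternion relations\<close>

definition imag_units :: "nat \<Rightarrow> cd set" where
  "imag_units n = signed_basis n - {cd_e n 0, cd_neg (cd_e n 0)}"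

lemma imag_units_signed_basis [simp]: "u \<in> imag_units n \<Longrightarrow> u \<in> signed_basis n"
  by (simp add: imag_units_def)

lemma cd_conj_imag_unit: "u \<in> imag_units n \<Longrightarrow> cd_conj u = cd_scale (- 1) u"
  using signed_basis_conj by (auto simp: imag_units_def cd_neg_def)

lemma imag_units_Suc_iff: "Db a b \<in> imag_units (Suc n) \<longleftrightarrow>
    a \<in> imag_units n \<and> b = cd_zero n \<or> a = cd_zero n \<and> b \<in> signed_basis n"
  using zero_not_signed_basis[of b n] zero_not_signed_basis[of "cd_neg (cd_e n 0)" n] cd_e_neq_zero[of n 0]
  by (auto simp: imag_units_def signed_basis_Suc_iff cd_neg_def signed_basis_scale)

lemma cd_basis'_imag_units: "cd_basis' n \<subseteq> imag_units n"
proof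
  fix a assume a: "a \<in> cd_basis' n"
  then have "a \<noteq> cd_neg (cd_e n 0)"
    using cd_basis_scale_eq[of a n "cd_e n 0" 1 "-1"] by (auto simp: cd_basis'_def cd_basis_def cd_neg_def)
  then show "a \<in> imag_units n" using a by (auto simp: imag_units_def signed_basis_def cd_basis'_def)
qed

lemma imag_units_cases:
  assumes "u \<in> imag_units n"
  obtains c v where "\<bar>c\<bar> = 1" "v \<in> cd_basis' n" "u = cd_scale c v"
proof -
  obtain c v where cv: "\<bar>c\<bar> = 1" "v \<in> cd_basis n" "u = cd_scale c v"
    using assms signed_basis_cases[of u n] by auto
  moreover have "v \<noteq> cd_e n 0"
    using cv assms by (auto simp: imag_units_def cd_neg_def abs_eq_iff')
  ultimately show ?thesis using that by (auto simp: cd_basis'_def)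
qed

definition eq_up_to_sign :: "cd \<Rightarrow> cd \<Rightarrow> bool" where
  "eq_up_to_sign u v \<longleftrightarrow> u = v \<or> u = cd_neg v"

lemma eq_up_to_sign_iff: "eq_up_to_sign u v \<longleftrightarrow> (\<exists>c. \<bar>c\<bar> = 1 \<and> u = cd_scale c v)"
  by (auto simp: eq_up_to_sign_def cd_neg_def abs_eq_iff' intro: exI[of _ 1] exI[of _ "-1"])

lemma eq_up_to_signI:
  assumes "cd_scale r u = cd_scale s v" "\<bar>r\<bar> = 1" "\<bar>s\<bar> = 1"
  shows "eq_up_to_sign u v"
proof -
  have "r * r = 1" using assms(2) by (auto simp: abs_eq_iff')
  then have "u = cd_scale (r * s) v" using arg_cong[OF assms(1), of "cd_scale r"] by simp
  then show ?thesis
    using assms(2,3) unfolding eq_up_to_sign_iff by (intro exI[of _ "r * s"]) (simp add: abs_mult)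
qed

lemma eq_up_to_sign_sym: "eq_up_to_sign u v \<Longrightarrow> eq_up_to_sign v u"
  by (auto simp: eq_up_to_sign_def cd_neg_def)

lemma eq_up_to_sign_basis: "u \<in> cd_basis n \<Longrightarrow> v \<in> cd_basis n \<Longrightarrow> eq_up_to_sign u v \<longleftrightarrow> u = v"
  using cd_basis_scale_eq[of u n v 1 "-1"] by (auto simp: eq_up_to_sign_def cd_neg_def)

text \<open>If \<open>u v\<close> is imaginary, then conjugating it reverses the factors and changes all signs.\<close>

lemma imag_units_anticommute:
  assumes "sign_params \<gamma> n" "u \<in> imag_units n" "v \<in> imag_units n" "\<not> eq_up_to_sign u v"
  shows "cd_mult \<gamma> n u v \<in> imag_units n"
    and "cd_mult \<gamma> n v u = cd_scale (- 1) (cd_mult \<gamma> n u v)"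
proof -
  obtain c where c: "\<bar>c\<bar> = 1" "cd_mult \<gamma> n u (cd_mult \<gamma> n u v) = cd_scale c v"
    using signed_basis_alternative[of \<gamma> n u] assms by auto
  \<comment> \<open>If \<open>u v\<close> were a sign \<open>d\<close>, then \<open>u (u v)\<close>
    would be \<open>d u\<close>, but alternativity makes it \<open>c v\<close>; so \<open>u\<close>
    and \<open>v\<close> would agree up to sign.\<close>
  have "\<not> eq_up_to_sign (cd_mult \<gamma> n u v) (cd_e n 0)"
  proof
    assume "eq_up_to_sign (cd_mult \<gamma> n u v) (cd_e n 0)"
    then obtain d where "\<bar>d\<bar> = 1" "cd_mult \<gamma> n u v = cd_scale d (cd_e n 0)"
      by (auto simp: eq_up_to_sign_iff)
    with c assms have "cd_scale d u = cd_scale c v" by simp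
    with \<open>\<bar>d\<bar> = 1\<close> c(1) assms(4) show False
      using eq_up_to_signI by blast
  qed
  then show *: "cd_mult \<gamma> n u v \<in> imag_units n"
    using assms signed_basis_mult by (auto simp: imag_units_def eq_up_to_sign_def)
  from cd_conj_imag_unit[OF *] show "cd_mult \<gamma> n v u = cd_scale (- 1) (cd_mult \<gamma> n u v)"
    using assms by (simp add: cd_conj_mult cd_conj_imag_unit)
qed

text \<open>\<open>1, x, p, q\<close> span a possibly split quaternion algebra. Only products of the
  forms \<open>u (u v)\<close> and \<open>(v u) u\<close> have to be evaluated, so alternativity of
  basis elements and anticommutativity replace associativity.\<close>

lemma quaternion_table:
  fixes \<xi> \<pi> :: real
  assumes sp: "sign_params \<gamma> n" and u: "x \<in> imag_units n" "p \<in> imag_units n" "\<not> eq_up_to_sign p x"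
    and sq: "cd_mult \<gamma> n x x = cd_scale \<xi> (cd_e n 0)" "cd_mult \<gamma> n p p = cd_scale \<pi> (cd_e n 0)"
    and q: "cd_mult \<gamma> n p x = q"
  shows "q \<in> imag_units n" "\<not> eq_up_to_sign q x" "\<not> eq_up_to_sign q p"
    "cd_mult \<gamma> n x p = cd_scale (- 1) q"
    "cd_mult \<gamma> n q x = cd_scale \<xi> p" "cd_mult \<gamma> n x q = cd_scale (- \<xi>) p"
    "cd_mult \<gamma> n p q = cd_scale \<pi> x" "cd_mult \<gamma> n q p = cd_scale (- \<pi>) x"
    "cd_mult \<gamma> n q q = cd_scale (- (\<xi> * \<pi>)) (cd_e n 0)"
proof -
  have CD: "x \<in> CD n" "p \<in> CD n" using u by auto
  show im: "q \<in> imag_units n" and xp: "cd_mult \<gamma> n x p = cd_scale (- 1) q"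
    using imag_units_anticommute[OF sp u(2,1,3)] q by auto
  have qCD: "q \<in> CD n" using im by auto
  show qx: "cd_mult \<gamma> n q x = cd_scale \<xi> p"
    using signed_basis_alt(2)[OF sp _ sq(1) CD(2)] u q by auto
  show pq: "cd_mult \<gamma> n p q = cd_scale \<pi> x"
    using signed_basis_alt(1)[OF sp _ sq(2) CD(1)] u q by auto
  have abs: "\<bar>\<xi>\<bar> = 1" "\<bar>\<pi>\<bar> = 1"
    using signed_basis_alt(3)[OF sp _ sq(1) CD(1)] signed_basis_alt(3)[OF sp _ sq(2) CD(1)] u by auto
  have scalar: "\<not> eq_up_to_sign v (cd_e n 0)" if "v \<in> imag_units n" for v
    using that by (auto simp: imag_units_def eq_up_to_sign_def)
  \<comment> \<open>If \<open>q\<close> were \<open>x\<close> up to sign, \<open>q x\<close> would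
    be a scalar, whereas it is \<open>\<xi> p\<close>. The next claim is the same argument with
    \<open>p q\<close>.\<close>
  show qx': "\<not> eq_up_to_sign q x"
  proof
    assume "eq_up_to_sign q x"
    then obtain c where "\<bar>c\<bar> = 1" "q = cd_scale c x" by (auto simp: eq_up_to_sign_iff)
    then have "cd_scale \<xi> p = cd_scale (c * \<xi>) (cd_e n 0)" using qx sq CD by simp
    then show False using eq_up_to_signI scalar u(2) abs \<open>\<bar>c\<bar> = 1\<close> by (metis abs_mult mult_1)
  qed
  show qp': "\<not> eq_up_to_sign q p"
  proof
    assume "eq_up_to_sign q p"
    then obtain c where "\<bar>c\<bar> = 1" "q = cd_scale c p" by (auto simp: eq_up_to_sign_iff)
    then have "cd_scale \<pi> x = cd_scale (c * \<pi>) (cd_e n 0)" using pq sq CD by simp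
    then show False using eq_up_to_signI scalar u(1) abs \<open>\<bar>c\<bar> = 1\<close> by (metis abs_mult mult_1)
  qed
  show "cd_mult \<gamma> n x q = cd_scale (- \<xi>) p"
    using imag_units_anticommute(2)[OF sp im u(1) qx'] qx by simp
  show qp: "cd_mult \<gamma> n q p = cd_scale (- \<pi>) x"
    using imag_units_anticommute(2)[OF sp u(2) im] qp' eq_up_to_sign_sym[of p q] pq by auto
  obtain \<omega> where \<omega>: "cd_mult \<gamma> n q q = cd_scale \<omega> (cd_e n 0)"
    using signed_basis_square[OF sp, of q] im by auto
  \<comment> \<open>The square of \<open>q\<close> is read off by evaluating \<open>q (q p)\<close>
    in two ways, by alternativity and by the entries already found.\<close>
  have "cd_scale \<omega> p = cd_mult \<gamma> n q (cd_mult \<gamma> n q p)"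
    using signed_basis_alt(1)[OF sp _ \<omega> CD(2)] im by simp
  also have "\<dots> = cd_scale (- (\<xi> * \<pi>)) p"
    using qp qx qCD CD by (simp add: mult.commute)
  finally show "cd_mult \<gamma> n q q = cd_scale (- (\<xi> * \<pi>)) (cd_e n 0)"
    using \<omega> signed_basis_scale_eq[of p n] u(2) by simp
qed

section \<open>Orthogonality and zero divisors\<close>

lemma cd_scale_eq_zero:
  assumes "cd_scale r z = cd_zero n" "r \<noteq> 0"
  shows "z = cd_zero n"
  using arg_cong[OF assms(1), of "cd_scale (1 / r)"] assms(2) by simp

lemma cd_add_eq_zero_iff:
  "u \<in> CD n \<Longrightarrow> v \<in> CD n \<Longrightarrow> cd_add u v = cd_zero n \<longleftrightarrow> u = cd_scale (- 1) v"
  by (induction n arbitrary: u v) (auto simp: add_eq_0_iff2)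

text \<open>Vanishing of a product with \<open>v = (C, D)\<close> gives two equations that express
  \<open>C\<close> and \<open>D\<close>, up to conjugation, through each other times
  \<open>y\<close>. Eliminating one of them multiplies the other by \<open>y\<close> twice, that is
  by \<open>\<gamma> n\<close>, while the signs in the equations give \<open>- \<gamma> n\<close>.
  Hence both vanish.\<close>

lemma not_zero_divisor:
  assumes sp: "sign_params \<gamma> n" and y: "y \<in> imag_units n"
    and sq: "cd_mult \<gamma> n y y = cd_scale (\<gamma> n) (cd_e n 0)" and \<kappa>: "\<bar>\<kappa>\<bar> = 1"
  shows "\<not> cd_zero_divisor \<gamma> (Suc n) (Db y (cd_scale \<kappa> (cd_e n 0)))"
proof
  assume "cd_zero_divisor \<gamma> (Suc n) (Db y (cd_scale \<kappa> (cd_e n 0)))"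
  then obtain v where v: "v \<in> CD (Suc n)" "v \<noteq> cd_zero (Suc n)"
    "cd_mult \<gamma> (Suc n) (Db y (cd_scale \<kappa> (cd_e n 0))) v = cd_zero (Suc n) \<or>
      cd_mult \<gamma> (Suc n) v (Db y (cd_scale \<kappa> (cd_e n 0))) = cd_zero (Suc n)"
    unfolding cd_zero_divisor_def by blast
  from v(1) obtain C D where CD: "C \<in> CD n" "D \<in> CD n" and vCD: "v = Db C D" by auto
  note zero = v(3)[unfolded vCD]
  have yS: "y \<in> signed_basis n" using y by simp
  \<comment> \<open>\<open>sign_params \<gamma> n\<close> stops below \<open>n\<close>; the sign of
    the last parameter comes from the square of the basis element \<open>y\<close>.\<close>
  have \<gamma>: "\<bar>\<gamma> n\<bar> = 1" using signed_basis_alt(3)[OF sp yS sq CD(1)] .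
  have nz: "\<gamma> n \<noteq> 0" "\<kappa> \<noteq> 0" using \<gamma> \<kappa> by auto
  have \<kappa>\<kappa>: "\<kappa> * \<kappa> = 1" "\<kappa> * (\<kappa> * r) = r" for r using \<kappa> by (auto simp: abs_eq_iff')
  have alt: "cd_mult \<gamma> n (cd_mult \<gamma> n z y) y = cd_scale (\<gamma> n) z" if "z \<in> CD n" for z
    using signed_basis_alt(2)[OF sp yS sq that] .
  have vanish: "z = cd_zero n" if "cd_scale (\<gamma> n) z = cd_scale (- \<gamma> n) z" "z \<in> CD n" for z
  proof (rule cd_scale_eq_zero)
    show "cd_scale (2 * \<gamma> n) z = cd_zero n"
      using cd_add_scale[of "\<gamma> n" z "\<gamma> n"] cd_add_scale[of "\<gamma> n" z "- \<gamma> n"] that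
      by (simp add: cd_scale_0[of _ n])
  qed (use nz in simp)
  have "C = cd_zero n \<and> D = cd_zero n"
    using zero
  proof
    assume "cd_mult \<gamma> (Suc n) (Db y (cd_scale \<kappa> (cd_e n 0))) (Db C D) = cd_zero (Suc n)"
    then have 1: "cd_mult \<gamma> n y C = cd_scale (- (\<gamma> n * \<kappa>)) (cd_conj D)"
      and 2: "cd_mult \<gamma> n D y = cd_scale (- \<kappa>) (cd_conj C)"
      using CD yS by (simp_all add: cd_add_eq_zero_iff[of _ n])
    \<comment> \<open>Conjugating the first equation moves \<open>y\<close> to the right, where
      \<open>alt\<close> applies.\<close>
    have 3: "cd_mult \<gamma> n (cd_conj C) y = cd_scale (\<gamma> n * \<kappa>) D"
      using arg_cong[OF 1, of "\<lambda>u. cd_scale (- 1) (cd_conj u)"] CD yS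
      by (simp add: cd_conj_mult cd_conj_imag_unit[OF y])
    have "cd_scale (\<gamma> n) (cd_conj C) = cd_mult \<gamma> n (cd_scale (\<gamma> n * \<kappa>) D) y"
      using alt[of "cd_conj C"] CD by (simp flip: 3)
    also have "\<dots> = cd_scale (- \<gamma> n) (cd_conj C)"
      using CD yS by (simp add: 2 mult.assoc \<kappa>\<kappa>)
    finally have "cd_conj C = cd_zero n" using vanish CD by simp
    then have "C = cd_zero n" by (metis cd_conj_conj cd_conj_zero)
    moreover from this have "cd_scale (\<gamma> n * \<kappa>) D = cd_zero n" using 3 yS by simp
    ultimately show ?thesis using cd_scale_eq_zero[of "\<gamma> n * \<kappa>" D n] nz by simp
  next
    assume "cd_mult \<gamma> (Suc n) (Db C D) (Db y (cd_scale \<kappa> (cd_e n 0))) = cd_zero (Suc n)"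
    then have 1: "cd_mult \<gamma> n C y = cd_scale (- (\<gamma> n * \<kappa>)) D"
      and 2: "cd_scale \<kappa> C = cd_mult \<gamma> n D y"
      using CD yS by (simp_all add: cd_add_eq_zero_iff[of _ n] cd_conj_imag_unit[OF y])
    have "cd_scale (\<gamma> n) C = cd_scale (- (\<gamma> n * \<kappa>)) (cd_mult \<gamma> n D y)"
      using alt[of C] CD yS by (simp add: 1)
    also have "\<dots> = cd_scale (- \<gamma> n) C"
      using CD yS by (simp add: mult.assoc \<kappa>\<kappa> flip: 2)
    finally have "C = cd_zero n" using vanish CD by simp
    moreover from this have "cd_scale (- (\<gamma> n * \<kappa>)) D = cd_zero n" using 1 yS by simp
    ultimately show ?thesis using cd_scale_eq_zero[of "- (\<gamma> n * \<kappa>)" D n] nz by simp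
  qed
  with v(2) show False by (simp add: vCD)
qed

text \<open>The four forms are needed because a coefficient 1 is simplified away and then no longer
  matches \<open>cd_scale\<close>.\<close>

lemma cd_add_multiples:
  "cd_add (cd_scale c a) (cd_scale d a) = cd_scale (c + d) a"
  "cd_add a (cd_scale d a) = cd_scale (1 + d) a"
  "cd_add (cd_scale c a) a = cd_scale (c + 1) a"
  "cd_add a a = cd_scale 2 a"
  using cd_add_scale[of c a d] cd_add_scale[of 1 a d] cd_add_scale[of c a 1] cd_add_scale[of 1 a 1]
  by simp_all

text \<open>All entries lie in the quaternion span of \<open>y\<close> and \<open>c\<close>, and
  each component of the products is a sum of two multiples of one element. The value
  \<open>- \<gamma> n\<close> of the square of \<open>y\<close> makes the coefficients
  cancel.\<close>

lemma orthogonal_split: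
  fixes \<beta> :: real
  assumes sp: "sign_params \<gamma> n" and y: "y \<in> imag_units n" "c \<in> imag_units n" "\<not> eq_up_to_sign c y"
    and sq: "cd_mult \<gamma> n y y = cd_scale (- \<gamma> n) (cd_e n 0)" and \<beta>: "\<bar>\<beta>\<bar> = 1"
  defines "w a \<eta> \<equiv> Db a (cd_scale \<eta> (cd_mult \<gamma> n a y))"
  shows "cd_orthogonal \<gamma> (Suc n) (w c \<beta>) (w y \<beta>)"
    and "cd_orthogonal \<gamma> (Suc n) (w c \<beta>) (w (cd_mult \<gamma> n c y) (- \<beta>))"
proof -
  obtain \<pi> where \<pi>: "\<bar>\<pi>\<bar> = 1" "cd_mult \<gamma> n c c = cd_scale \<pi> (cd_e n 0)"
    using signed_basis_square[OF sp, of c] y by auto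
  define q where "q = cd_mult \<gamma> n c y"
  note tab = quaternion_table[OF sp y sq \<pi>(2) q_def[symmetric]]
  have im: "y \<in> CD n" "c \<in> CD n" "q \<in> CD n" using y tab(1) by auto
  \<comment> \<open>Once these three signs are numerals, the table evaluates every product, and only
    arithmetic on the coefficients remains.\<close>
  have signs: "\<gamma> n = 1 \<or> \<gamma> n = -1" "\<beta> = 1 \<or> \<beta> = -1" "\<pi> = 1 \<or> \<pi> = -1"
    using signed_basis_alt(3)[OF sp _ sq im(1)] y \<beta> \<pi>(1) by (auto simp: abs_eq_iff')
  note calc = tab(4-) sq \<pi>(2) im q_def[symmetric] cd_conj_imag_unit[OF y(1)] cd_conj_imag_unit[OF y(2)]
    cd_conj_imag_unit[OF tab(1)] cd_add_multiples cd_scale_0[of _ n] cd_orthogonal_def w_def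
  show "cd_orthogonal \<gamma> (Suc n) (w c \<beta>) (w y \<beta>)"
    using signs by (elim disjE) (simp_all add: calc)
  show "cd_orthogonal \<gamma> (Suc n) (w c \<beta>) (w (cd_mult \<gamma> n c y) (- \<beta>))"
    using signs by (elim disjE) (simp_all add: calc)
qed

text \<open>
  The components in \<open>A\<^sub>m\<close> of all elements below are, up to sign, among \<open>0, 1, x, p, px\<close>, so
  orthogonality can be read off the quaternion table.
\<close>

lemma orthogonal_even:
  fixes \<beta> :: real and m :: nat
  assumes sp: "sign_params \<gamma> (Suc m)" and x: "x \<in> imag_units m" "p \<in> imag_units m"
      "\<not> eq_up_to_sign p x"
    and sq: "cd_mult \<gamma> m x x = cd_scale (\<gamma> (Suc m)) (cd_e m 0)" and \<beta>: "\<bar>\<beta>\<bar> = 1"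
  defines "w a \<eta> \<equiv> Db a (cd_scale \<eta> (cd_mult \<gamma> (Suc m) a (Db x (cd_zero m))))"
  assumes c: "c = Db p (cd_zero m) \<or> c = Db (cd_zero m) p"
  shows "cd_orthogonal \<gamma> (Suc (Suc m)) (w c \<beta>) (w (Db (cd_zero m) (cd_e m 0)) (- \<beta>))"
    and "cd_orthogonal \<gamma> (Suc (Suc m)) (w c \<beta>) (w (Db (cd_zero m) x) (- \<beta>))"
    and "cd_orthogonal \<gamma> (Suc (Suc m)) (w (Db p (cd_zero m)) \<beta>) (w (Db (cd_zero m) p) (- \<beta>))"
proof -
  have sm: "sign_params \<gamma> m" "\<bar>\<gamma> m\<bar> = 1" using sp by (simp_all add: sign_params_Suc)
  obtain \<pi> where \<pi>: "\<bar>\<pi>\<bar> = 1" "cd_mult \<gamma> m p p = cd_scale \<pi> (cd_e m 0)"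
    using signed_basis_square[OF sm(1), of p] x by auto
  define q where "q = cd_mult \<gamma> m p x"
  note tab = quaternion_table[OF sm(1) x sq \<pi>(2) q_def[symmetric]]
  have im: "x \<in> CD m" "p \<in> CD m" "q \<in> CD m" using x tab(1) by auto
  have signs: "\<gamma> (Suc m) = 1 \<or> \<gamma> (Suc m) = -1" "\<gamma> m = 1 \<or> \<gamma> m = -1"
    "\<beta> = 1 \<or> \<beta> = -1" "\<pi> = 1 \<or> \<pi> = -1"
    using signed_basis_alt(3)[OF sm(1) _ sq im(1)] x sm(2) \<beta> \<pi>(1) by (auto simp: abs_eq_iff')
  note calc = tab(4-) sq \<pi>(2) im q_def[symmetric] cd_conj_imag_unit[OF x(1)] cd_conj_imag_unit[OF x(2)]
    cd_conj_imag_unit[OF tab(1)] cd_add_multiples cd_scale_0[of _ m] cd_orthogonal_def w_def cd_neg_def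
  show "cd_orthogonal \<gamma> (Suc (Suc m)) (w c \<beta>) (w (Db (cd_zero m) (cd_e m 0)) (- \<beta>))"
    using signs c by (elim disjE) (simp_all add: calc)
  show "cd_orthogonal \<gamma> (Suc (Suc m)) (w c \<beta>) (w (Db (cd_zero m) x) (- \<beta>))"
    using signs c by (elim disjE) (simp_all add: calc)
  show "cd_orthogonal \<gamma> (Suc (Suc m)) (w (Db p (cd_zero m)) \<beta>) (w (Db (cd_zero m) p) (- \<beta>))"
    using signs by (elim disjE) (simp_all add: calc)
qed

text \<open>The counterpart for \<open>y = (0, x)\<close>. The square of \<open>y\<close> is
  \<open>- \<gamma> m\<close> times that of \<open>x\<close>, so the hypothesis on \<open>x\<close>
  says that \<open>y\<close> has square \<open>\<gamma> (Suc m)\<close>.\<close>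

lemma orthogonal_odd:
  fixes \<beta> :: real and m :: nat
  assumes sp: "sign_params \<gamma> (Suc m)" and x: "x \<in> imag_units m" "p \<in> imag_units m"
      "\<not> eq_up_to_sign p x"
    and sq: "cd_mult \<gamma> m x x = cd_scale (- (\<gamma> m * \<gamma> (Suc m))) (cd_e m 0)" and \<beta>: "\<bar>\<beta>\<bar> = 1"
  defines "w a \<eta> \<equiv> Db a (cd_scale \<eta> (cd_mult \<gamma> (Suc m) a (Db (cd_zero m) x)))"
  assumes c: "c = Db p (cd_zero m) \<or> c = Db (cd_zero m) p"
  shows "cd_orthogonal \<gamma> (Suc (Suc m)) (w c \<beta>) (w (Db (cd_zero m) (cd_e m 0)) (- \<beta>))"
    and "cd_orthogonal \<gamma> (Suc (Suc m)) (w c \<beta>) (w (Db x (cd_zero m)) (- \<beta>))"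
    and "cd_orthogonal \<gamma> (Suc (Suc m)) (w (Db p (cd_zero m)) \<beta>) (w (Db (cd_zero m) p) (- \<beta>))"
proof -
  have sm: "sign_params \<gamma> m" "\<bar>\<gamma> m\<bar> = 1" using sp by (simp_all add: sign_params_Suc)
  obtain \<pi> where \<pi>: "\<bar>\<pi>\<bar> = 1" "cd_mult \<gamma> m p p = cd_scale \<pi> (cd_e m 0)"
    using signed_basis_square[OF sm(1), of p] x by auto
  define q where "q = cd_mult \<gamma> m p x"
  note tab = quaternion_table[OF sm(1) x sq \<pi>(2) q_def[symmetric]]
  have im: "x \<in> CD m" "p \<in> CD m" "q \<in> CD m" using x tab(1) by auto
  have signs: "\<gamma> (Suc m) = 1 \<or> \<gamma> (Suc m) = -1" "\<gamma> m = 1 \<or> \<gamma> m = -1"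
    "\<beta> = 1 \<or> \<beta> = -1" "\<pi> = 1 \<or> \<pi> = -1"
    using signed_basis_alt(3)[OF sm(1) _ sq im(1)] x sm(2) \<beta> \<pi>(1) by (auto simp: abs_eq_iff')
  note calc = tab(4-) sq \<pi>(2) im q_def[symmetric] cd_conj_imag_unit[OF x(1)] cd_conj_imag_unit[OF x(2)]
    cd_conj_imag_unit[OF tab(1)] cd_add_multiples cd_scale_0[of _ m] cd_orthogonal_def w_def cd_neg_def
  show "cd_orthogonal \<gamma> (Suc (Suc m)) (w c \<beta>) (w (Db (cd_zero m) (cd_e m 0)) (- \<beta>))"
    using signs c by (elim disjE) (simp_all add: calc)
  show "cd_orthogonal \<gamma> (Suc (Suc m)) (w c \<beta>) (w (Db x (cd_zero m)) (- \<beta>))"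
    using signs c by (elim disjE) (simp_all add: calc)
  show "cd_orthogonal \<gamma> (Suc (Suc m)) (w (Db p (cd_zero m)) \<beta>) (w (Db (cd_zero m) p) (- \<beta>))"
    using signs by (elim disjE) (simp_all add: calc)
qed

section \<open>The graphs \<open>C(y)\<close>\<close>

lemma cd_line_eqE:
  assumes "cd_line u = cd_line v"
  obtains r where "u = cd_scale r v"
proof -
  have "u \<in> cd_line u" unfolding cd_line_def by (rule range_eqI[of _ _ 1]) simp
  then show ?thesis using that unfolding assms by (auto simp: cd_line_def)
qed

lemma cd_line_minus: "cd_line (cd_scale (- 1) u) = cd_line u"
  unfolding cd_line_def by (auto simp: image_iff) (metis minus_minus)

lemma cd_line_sign: "\<bar>c\<bar> = 1 \<Longrightarrow> cd_line (cd_scale c u) = cd_line u"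
  using cd_line_minus by (auto simp: abs_eq_iff')

lemma cd_orthogonal_scale:
  assumes "u \<in> CD n" "v \<in> CD n" "cd_orthogonal \<gamma> n u v"
  shows "cd_orthogonal \<gamma> n (cd_scale r u) (cd_scale s v)"
  using assms by (simp add: cd_orthogonal_def)

lemma cd_orthogonal_sym: "cd_orthogonal \<gamma> n u v \<Longrightarrow> cd_orthogonal \<gamma> n v u"
  by (simp add: cd_orthogonal_def)

lemma Gamma_e_gens_alt: "(a, b) \<in> Gamma_e_gens \<gamma> n \<longleftrightarrow>
    a \<in> cd_basis' n \<and> b \<in> signed_basis n \<and> cd_zero_divisor \<gamma> (Suc n) (Db a b)"
  by (simp add: Gamma_e_gens_def signed_basis_def)

lemma C_graph_arcs_iff: "u \<rightarrow>\<^bsub>C_graph \<gamma> n y\<^esub> v \<longleftrightarrow>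
    u \<in> verts (C_graph \<gamma> n y) \<and> v \<in> verts (C_graph \<gamma> n y) \<and> (u, v) \<in> parcs (Gamma_e \<gamma> n)"
  by (auto simp: C_graph_def arcs_ends_def arc_to_ends_def)

text \<open>An arc only supplies some orthogonal generators of the two lines; \<open>u\<close> and
  \<open>v\<close> are multiples of these, and scaling preserves orthogonality.\<close>

lemma C_graph_arc_orthogonal:
  assumes "cd_line u \<rightarrow>\<^bsub>C_graph \<gamma> n y\<^esub> cd_line v"
  shows "cd_orthogonal \<gamma> (Suc n) u v"
proof -
  obtain a b c d where g: "(a, b) \<in> Gamma_e_gens \<gamma> n" "(c, d) \<in> Gamma_e_gens \<gamma> n"
      "cd_line u = cd_line (Db a b)" "cd_line v = cd_line (Db c d)"
      "cd_orthogonal \<gamma> (Suc n) (Db a b) (Db c d)"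
    using assms by (auto simp: C_graph_arcs_iff Gamma_e_def)
  then show ?thesis
    using cd_line_eqE[of u "Db a b"] cd_line_eqE[of v "Db c d"]
      cd_orthogonal_scale[of "Db a b" "Suc n" "Db c d"]
    by (metis Gamma_e_gens_alt cd_zero_divisor_def)
qed

lemma C_graph_arcI:
  assumes "(a, b) \<in> Gamma_e_gens \<gamma> n" "(c, d) \<in> Gamma_e_gens \<gamma> n"
    and "cd_mult \<gamma> n a b \<in> {y, cd_neg y}" "cd_mult \<gamma> n c d \<in> {y, cd_neg y}"
    and "cd_line (Db a b) \<noteq> cd_line (Db c d)" "cd_orthogonal \<gamma> (Suc n) (Db a b) (Db c d)"
  shows "cd_line (Db a b) \<rightarrow>\<^bsub>C_graph \<gamma> n y\<^esub> cd_line (Db c d)"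
proof -
  have "cd_line (Db a b) \<in> verts (C_graph \<gamma> n y)" "cd_line (Db c d) \<in> verts (C_graph \<gamma> n y)"
    using assms(1-4) unfolding C_graph_def induce_subgraph_verts by blast+
  moreover have "(cd_line (Db a b), cd_line (Db c d)) \<in> parcs (Gamma_e \<gamma> n)"
    using assms unfolding Gamma_e_def pair_pre_digraph.simps by blast
  ultimately show ?thesis by (simp add: C_graph_arcs_iff)
qed

text \<open>Coordinates on \<open>C(y)\<close>: for a basis element \<open>a\<close>, alternativity
  gives \<open>a (a y) = \<plusminus>y\<close>, so \<open>a\<close> and the sign
  \<open>\<beta>\<close> describe a vertex whenever the generator is a zero divisor. Replacing
  \<open>a\<close> by its negative does not change the line.\<close>

definition vtx :: "(nat \<Rightarrow> real) \<Rightarrow> nat \<Rightarrow> cd \<Rightarrow> cd \<Rightarrow> real \<Rightarrow> cd set" where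
  "vtx \<gamma> n y a \<beta> = cd_line (Db a (cd_scale \<beta> (cd_mult \<gamma> n a y)))"

lemma vtx_scale:
  assumes "\<bar>c\<bar> = 1" "a \<in> CD n" "y \<in> CD n"
  shows "vtx \<gamma> n y (cd_scale c a) \<beta> = vtx \<gamma> n y a \<beta>"
  using cd_line_sign[OF assms(1), of "Db a (cd_scale \<beta> (cd_mult \<gamma> n a y))"] assms(2,3)
  by (simp add: vtx_def mult.commute)

text \<open>Multiplying \<open>a b = \<plusminus>y\<close> by \<open>a\<close> on the left recovers
  \<open>b\<close> as \<open>a y\<close> up to sign.\<close>

lemma C_graph_verts:
  assumes "v \<in> verts (C_graph \<gamma> n y)" "sign_params \<gamma> n" "y \<in> CD n"
  obtains a \<beta> where "a \<in> cd_basis' n" "\<bar>\<beta>\<bar> = 1" "v = vtx \<gamma> n y a \<beta>"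
    "cd_zero_divisor \<gamma> (Suc n) (Db a (cd_scale \<beta> (cd_mult \<gamma> n a y)))"
proof -
  obtain a b where ab: "a \<in> cd_basis' n" "b \<in> signed_basis n" "v = cd_line (Db a b)"
      "cd_mult \<gamma> n a b \<in> {y, cd_neg y}" "cd_zero_divisor \<gamma> (Suc n) (Db a b)"
    using assms(1) by (auto simp: C_graph_def Gamma_e_gens_alt)
  obtain \<eta> where \<eta>: "\<bar>\<eta>\<bar> = 1" "cd_mult \<gamma> n a b = cd_scale \<eta> y"
    using ab(4) that[of 1] that[of "- 1"] by (auto simp: cd_neg_def)
  have a: "a \<in> signed_basis n" using ab(1) cd_basis'_imag_units by fastforce
  obtain \<alpha> where \<alpha>: "\<bar>\<alpha>\<bar> = 1" "cd_mult \<gamma> n a (cd_mult \<gamma> n a b) = cd_scale \<alpha> b"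
    using signed_basis_alternative[OF assms(2) a] ab(2) by auto
  have "b = cd_scale \<alpha> (cd_scale \<alpha> b)" using \<alpha>(1) by (auto simp: abs_eq_iff')
  also have "\<dots> = cd_scale (\<alpha> * \<eta>) (cd_mult \<gamma> n a y)"
    using \<alpha>(2) \<eta>(2) a assms(3) by (metis cd_mult_scale(2) cd_scale_scale signed_basis_CD)
  finally show ?thesis
    using ab \<alpha> \<eta> by (intro that[of a "\<alpha> * \<eta>"]) (auto simp: vtx_def abs_mult)
qed

text \<open>Here \<open>a\<close> and \<open>c\<close> may carry signs, while generators must start
  with an unsigned basis element; the proof passes to the unsigned \<open>a'\<close> and
  \<open>c'\<close>. The zero divisor condition is automatic, because each of two nonzero orthogonal
  elements witnesses it for the other.\<close>

lemma C_graph_vtx_arc: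
  fixes \<gamma> n y
  defines "w a \<beta> \<equiv> Db a (cd_scale \<beta> (cd_mult \<gamma> n a y))"
  assumes sp: "sign_params \<gamma> n" and y: "y \<in> signed_basis n"
    and a: "a \<in> imag_units n" "c \<in> imag_units n" "\<not> eq_up_to_sign a c"
    and s: "\<bar>\<beta>\<bar> = 1" "\<bar>\<delta>\<bar> = 1"
    and orth: "cd_orthogonal \<gamma> (Suc n) (w a \<beta>) (w c \<delta>)"
  shows "vtx \<gamma> n y a \<beta> \<rightarrow>\<^bsub>C_graph \<gamma> n y\<^esub> vtx \<gamma> n y c \<delta>"
    "vtx \<gamma> n y c \<delta> \<rightarrow>\<^bsub>C_graph \<gamma> n y\<^esub> vtx \<gamma> n y a \<beta>"
proof -
  obtain ra a' where a': "\<bar>ra\<bar> = 1" "a' \<in> cd_basis' n" "a = cd_scale ra a'"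
    using imag_units_cases[OF a(1)] .
  obtain rc c' where c': "\<bar>rc\<bar> = 1" "c' \<in> cd_basis' n" "c = cd_scale rc c'"
    using imag_units_cases[OF a(2)] .
  have SB: "e \<in> signed_basis n" "cd_mult \<gamma> n e y \<in> signed_basis n"
    "cd_scale \<beta> (cd_mult \<gamma> n e y) \<in> signed_basis n" "cd_scale \<delta> (cd_mult \<gamma> n e y) \<in> signed_basis n"
    if "e \<in> cd_basis' n" for e
    using that cd_basis'_imag_units signed_basis_mult[OF sp _ y] signed_basis_scale s
    by (auto simp: subset_iff)
  have wCD: "w e \<eta> \<in> CD (Suc n)" if "e \<in> cd_basis' n" for e \<eta>
    using SB(1)[OF that] y by (simp add: w_def)
  \<comment> \<open>\<open>w\<close> is homogeneous in its first argument, and a sign is its own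
    inverse.\<close>
  have "w a' \<beta> = cd_scale ra (w a \<beta>)" "w c' \<delta> = cd_scale rc (w c \<delta>)"
    using a' c' SB y by (auto simp: w_def abs_eq_iff')
  moreover have "w a \<beta> \<in> CD (Suc n)" "w c \<delta> \<in> CD (Suc n)" using a y by (auto simp: w_def)
  ultimately have orth': "cd_orthogonal \<gamma> (Suc n) (w a' \<beta>) (w c' \<delta>)"
    using cd_orthogonal_scale[OF _ _ orth] by auto
  have vtx: "vtx \<gamma> n y a \<beta> = cd_line (w a' \<beta>)" "vtx \<gamma> n y c \<delta> = cd_line (w c' \<delta>)"
    using a' c' SB y vtx_scale by (auto simp: vtx_def w_def)
  have ne: "w e \<eta> \<noteq> cd_zero (Suc n)" if "e \<in> cd_basis' n" for e \<eta>
    using zero_not_signed_basis[OF SB(1)[OF that]] by (auto simp: w_def)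
  have zd: "cd_zero_divisor \<gamma> (Suc n) (w a' \<beta>)" "cd_zero_divisor \<gamma> (Suc n) (w c' \<delta>)"
    using orth' wCD ne a'(2) c'(2) unfolding cd_zero_divisor_def cd_orthogonal_def by blast+
  have prod: "cd_mult \<gamma> n e (cd_scale \<eta> (cd_mult \<gamma> n e y)) \<in> {y, cd_neg y}"
    if "e \<in> cd_basis' n" "\<bar>\<eta>\<bar> = 1" for e \<eta>
  proof -
    obtain \<alpha> where "\<bar>\<alpha>\<bar> = 1" "cd_mult \<gamma> n e (cd_mult \<gamma> n e y) = cd_scale \<alpha> y"
      using signed_basis_alternative[OF sp SB(1)[OF \<open>e \<in> cd_basis' n\<close>]] y by auto
    then show ?thesis using that SB y by (auto simp: cd_neg_def abs_eq_iff')
  qed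
  have "a' \<noteq> c'"
  proof
    assume "a' = c'"
    then have "cd_scale rc a = cd_scale ra c" using a' c' by (simp add: mult.commute)
    then show False using a(3) eq_up_to_signI a'(1) c'(1) by blast
  qed
  have "cd_line (w a' \<beta>) \<noteq> cd_line (w c' \<delta>)"
  proof
    assume "cd_line (w a' \<beta>) = cd_line (w c' \<delta>)"
    then obtain r where "w a' \<beta> = cd_scale r (w c' \<delta>)" by (rule cd_line_eqE)
    then have "cd_scale 1 a' = cd_scale r c'" by (simp add: w_def)
    then show False
      using cd_basis_scale_eq[of a' n c' 1 r] \<open>a' \<noteq> c'\<close> a' c' by (auto simp: cd_basis'_def)
  qed
  moreover have "(a', cd_scale \<beta> (cd_mult \<gamma> n a' y)) \<in> Gamma_e_gens \<gamma> n"
    "(c', cd_scale \<delta> (cd_mult \<gamma> n c' y)) \<in> Gamma_e_gens \<gamma> n"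
    using a' c' SB zd by (auto simp: Gamma_e_gens_alt w_def)
  ultimately show "vtx \<gamma> n y a \<beta> \<rightarrow>\<^bsub>C_graph \<gamma> n y\<^esub> vtx \<gamma> n y c \<delta>"
    "vtx \<gamma> n y c \<delta> \<rightarrow>\<^bsub>C_graph \<gamma> n y\<^esub> vtx \<gamma> n y a \<beta>"
    using orth' cd_orthogonal_sym[OF orth'] prod[OF a'(2) s(1)] prod[OF c'(2) s(2)]
    unfolding vtx w_def by (auto intro: C_graph_arcI)
qed

lemma vtx_opposite_far:
  assumes "sign_params \<gamma> n" "y \<in> signed_basis n" "a \<in> imag_units n"
  shows "vtx \<gamma> n y a 1 \<noteq> vtx \<gamma> n y a (- 1)"
    and "\<not> vtx \<gamma> n y a 1 \<rightarrow>\<^bsub>C_graph \<gamma> n y\<^esub> vtx \<gamma> n y a (- 1)"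
    and "\<not> (vtx \<gamma> n y a 1 \<rightarrow>\<^bsub>C_graph \<gamma> n y\<^esub> w \<and> w \<rightarrow>\<^bsub>C_graph \<gamma> n y\<^esub> vtx \<gamma> n y a (- 1))"
proof -
  define b where "b = cd_mult \<gamma> n a y"
  have b: "b \<in> signed_basis n" and a: "a \<in> signed_basis n"
    using assms signed_basis_mult by (auto simp: b_def)
  have v: "vtx \<gamma> n y a 1 = cd_line (Db a b)" "vtx \<gamma> n y a (- 1) = cd_line (Db a (cd_scale (- 1) b))"
    by (simp_all add: vtx_def b_def)
  show "vtx \<gamma> n y a 1 \<noteq> vtx \<gamma> n y a (- 1)"
  proof
    assume "vtx \<gamma> n y a 1 = vtx \<gamma> n y a (- 1)"
    then obtain r where "Db a b = cd_scale r (Db a (cd_scale (- 1) b))"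
      using cd_line_eqE v by metis
    then have "cd_scale 1 a = cd_scale r a" "cd_scale 1 b = cd_scale (- r) b" by simp_all
    then have "1 = r" "1 = - r" using signed_basis_scale_eq[OF a] signed_basis_scale_eq[OF b] by blast+
    then show False by simp
  qed
  show "\<not> vtx \<gamma> n y a 1 \<rightarrow>\<^bsub>C_graph \<gamma> n y\<^esub> vtx \<gamma> n y a (- 1)"
  proof
    assume "vtx \<gamma> n y a 1 \<rightarrow>\<^bsub>C_graph \<gamma> n y\<^esub> vtx \<gamma> n y a (- 1)"
    then have "cd_orthogonal \<gamma> (Suc n) (Db a b) (Db a (cd_scale (- 1) b))"
      unfolding v by (rule C_graph_arc_orthogonal)
    \<comment> \<open>This is the second component of the product, \<open>- b a\<close> plus
      \<open>b\<close> times \<open>cd_conj a\<close>, where \<open>cd_conj a\<close> is the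
      negative of \<open>a\<close>.\<close>
    then have "cd_scale (- 2) (cd_mult \<gamma> n b a) = cd_zero n"
      using a b assms(3) by (simp add: cd_orthogonal_def cd_conj_imag_unit cd_add_scale)
    then show False
      using signed_basis_scale_eq_zero[OF signed_basis_mult[OF assms(1) b a]] by simp
  qed
  show "\<not> (vtx \<gamma> n y a 1 \<rightarrow>\<^bsub>C_graph \<gamma> n y\<^esub> w \<and> w \<rightarrow>\<^bsub>C_graph \<gamma> n y\<^esub> vtx \<gamma> n y a (- 1))"
  proof
    assume asm: "vtx \<gamma> n y a 1 \<rightarrow>\<^bsub>C_graph \<gamma> n y\<^esub> w \<and> w \<rightarrow>\<^bsub>C_graph \<gamma> n y\<^esub> vtx \<gamma> n y a (- 1)"
    then have "w \<in> verts (C_graph \<gamma> n y)" by (simp add: C_graph_arcs_iff)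
    then obtain c \<delta> where c: "c \<in> cd_basis' n" "w = vtx \<gamma> n y c \<delta>"
      using C_graph_verts assms(1,2) by (metis signed_basis_CD)
    define d where "d = cd_scale \<delta> (cd_mult \<gamma> n c y)"
    have cS: "c \<in> signed_basis n" using c cd_basis'_imag_units by fastforce
    then have dCD: "d \<in> CD n" using assms(2) by (simp add: d_def)
    have w: "w = cd_line (Db c d)" by (simp add: c(2) vtx_def d_def)
    have "cd_orthogonal \<gamma> (Suc n) (Db c d) (Db a b)"
      using asm C_graph_arc_orthogonal cd_orthogonal_sym unfolding v w by blast
    moreover have "cd_orthogonal \<gamma> (Suc n) (Db c d) (Db a (cd_scale (- 1) b))"
      using asm C_graph_arc_orthogonal unfolding v w by blast
    ultimately have "cd_zero (Suc n) = cd_add (cd_mult \<gamma> (Suc n) (Db c d) (Db a b))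
        (cd_mult \<gamma> (Suc n) (Db c d) (Db a (cd_scale (- 1) b)))"
      by (simp add: cd_orthogonal_def)
    also have "\<dots> = cd_mult \<gamma> (Suc n) (Db c d) (cd_add (Db a b) (Db a (cd_scale (- 1) b)))"
      using a b cS dCD by (subst cd_mult_add(1)) auto
    also have "cd_add (Db a b) (Db a (cd_scale (- 1) b)) = Db (cd_scale 2 a) (cd_zero n)"
      using cd_add_scale[of 1 b "- 1"] cd_add_scale[of 1 a 1] cd_scale_0[of b n] b by simp
    \<comment> \<open>The first component of \<open>(c, d) (2a, 0)\<close> is \<open>2 c a\<close>,
      and \<open>c a\<close> is again a signed basis element, hence nonzero.\<close>
    finally have "cd_scale 2 (cd_mult \<gamma> n c a) = cd_zero n"
      using a b cS dCD by simp
    then show False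
      using signed_basis_scale_eq_zero[OF signed_basis_mult[OF assms(1) cS a]] by simp
  qed
qed

text \<open>Converts the boolean class index of \<open>graph_diameter_eq_3\<close> into the sign
  coordinate of \<open>vtx\<close>; negating the index negates the sign.\<close>

definition sgn_of :: "bool \<Rightarrow> real" where
  "sgn_of i = (if i then 1 else - 1)"

lemma abs_sgn_of [simp]: "\<bar>sgn_of i\<bar> = 1"
  by (simp add: sgn_of_def)

lemma sgn_of_not [simp]: "sgn_of (\<not> i) = - sgn_of i"
  by (simp add: sgn_of_def)

lemma sgn_of_cases: "\<bar>\<beta>\<bar> = 1 \<Longrightarrow> \<exists>i. \<beta> = sgn_of i"
  by (auto simp: sgn_of_def abs_eq_iff' intro: exI[of _ True] exI[of _ False])

lemma cd_basis'_Suc_iff: "Db a b \<in> cd_basis' (Suc n) \<longleftrightarrow>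
    a \<in> cd_basis' n \<and> b = cd_zero n \<or> a = cd_zero n \<and> b \<in> cd_basis n"
  using zero_not_signed_basis[of b n] cd_e_neq_zero[of n 0]
  by (auto simp: cd_basis'_def cd_basis_Suc signed_basis_def)

lemma cd_basis'_subset: "cd_basis' n \<subseteq> cd_basis n"
  by (auto simp: cd_basis'_def)

text \<open>Makes the classes \<open>S\<close> nonempty. Two distinct imaginary basis elements are
  exhibited, one in each half of the algebra; \<open>A_1\<close> has only one, whence the
  bound.\<close>

lemma cd_basis'_other:
  assumes "n \<ge> 2"
  obtains p where "p \<in> cd_basis' n" "p \<noteq> x"
proof -
  obtain k where n: "n = Suc (Suc k)"
    using assms by (metis add_2_eq_Suc le_Suc_ex)
  have one: "cd_e j 0 \<in> cd_basis j" for j by (auto simp: cd_basis_def)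
  have "Db (cd_zero (Suc k)) (cd_e (Suc k) 0) \<in> cd_basis' n"
    using one by (simp add: n cd_basis'_Suc_iff del: cd_e.simps)
  moreover have "Db (Db (cd_zero k) (cd_e k 0)) (cd_zero (Suc k)) \<in> cd_basis' n"
    using one by (simp add: n cd_basis'_Suc_iff)
  moreover have "Db (cd_zero (Suc k)) (cd_e (Suc k) 0) \<noteq> Db (Db (cd_zero k) (cd_e k 0)) (cd_zero (Suc k))"
    using cd_e_neq_zero[of k 0] by auto
  ultimately show ?thesis using that by metis
qed

section \<open>The diameter in the two cases for the square of \<open>y\<close>\<close>

lemma diameter_split:
  assumes sp: "sign_params \<gamma> n" and n: "n \<ge> 2" and y: "y \<in> cd_basis' n"
    and sq: "cd_mult \<gamma> n y y = cd_scale (- \<gamma> n) (cd_e n 0)"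
  shows "graph_diameter (C_graph \<gamma> n y) = 3"
proof -
  let ?G = "C_graph \<gamma> n y"
  define S where "S i = {vtx \<gamma> n y c (sgn_of i) | c. c \<in> imag_units n \<and> \<not> eq_up_to_sign c y}" for i
  define T where "T i = {vtx \<gamma> n y y (sgn_of i)}" for i
  have yI: "y \<in> imag_units n" using y cd_basis'_imag_units by auto
  then have yS: "y \<in> signed_basis n" by simp
  note orth = orthogonal_split[OF sp yI _ _ sq]
  have ST: "s \<rightarrow>\<^bsub>?G\<^esub> t \<and> t \<rightarrow>\<^bsub>?G\<^esub> s" if "s \<in> S i" "t \<in> T i" for i s t
    using that C_graph_vtx_arc[OF sp yS _ yI] orth(1)[of _ "sgn_of i"] unfolding S_def T_def by auto
  have SS: "\<exists>s' \<in> S (\<not> i). s \<rightarrow>\<^bsub>?G\<^esub> s' \<and> s' \<rightarrow>\<^bsub>?G\<^esub> s" if s: "s \<in> S i" for i s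
  proof -
    obtain c where c: "c \<in> imag_units n" "\<not> eq_up_to_sign c y" "s = vtx \<gamma> n y c (sgn_of i)"
      using s by (auto simp: S_def)
    obtain \<pi> where \<pi>: "cd_mult \<gamma> n c c = cd_scale \<pi> (cd_e n 0)"
      using signed_basis_square[OF sp, of c] c by auto
    note tab = quaternion_table[OF sp yI c(1,2) sq \<pi> refl]
    \<comment> \<open>The partner has first entry \<open>c y\<close> and the opposite sign; it stays
      in the \<open>S\<close> classes because \<open>c y\<close> is not \<open>y\<close> up to
      sign.\<close>
    have "vtx \<gamma> n y (cd_mult \<gamma> n c y) (sgn_of (\<not> i)) \<in> S (\<not> i)"
      using tab(1,2) unfolding S_def by blast
    moreover have "\<not> eq_up_to_sign c (cd_mult \<gamma> n c y)" using tab(3) eq_up_to_sign_sym by blast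
    ultimately show ?thesis
      using C_graph_vtx_arc[OF sp yS c(1) tab(1), of "sgn_of i" "sgn_of (\<not> i)"]
        orth(2)[OF c(1,2), of "sgn_of i"] c(3) by auto
  qed
  obtain p where "p \<in> cd_basis' n" "p \<noteq> y" using cd_basis'_other[OF n] .
  then have "p \<in> imag_units n" "\<not> eq_up_to_sign p y"
    using eq_up_to_sign_basis[of p n y] y cd_basis'_imag_units by (auto simp: cd_basis'_def)
  then have ne: "S i \<noteq> {}" "T i \<noteq> {}" for i by (auto simp: S_def T_def)
  have "v \<in> (\<Union>i. S i \<union> T i)" if v: "v \<in> verts ?G" for v
  proof -
    obtain a \<beta> where a: "a \<in> cd_basis' n" "\<bar>\<beta>\<bar> = 1" "v = vtx \<gamma> n y a \<beta>"
      using C_graph_verts[OF v sp signed_basis_CD[OF yS]] by blast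
    obtain i where i: "\<beta> = sgn_of i" using sgn_of_cases a(2) by blast
    have "a \<in> imag_units n" using a(1) cd_basis'_imag_units by auto
    moreover have "a = y \<or> \<not> eq_up_to_sign a y"
      using eq_up_to_sign_basis[of a n y] a(1) y by (auto simp: cd_basis'_def)
    ultimately have "v \<in> S i \<or> v \<in> T i"
      unfolding S_def T_def a(3) i by blast
    then show ?thesis by blast
  qed
  then have cover: "verts ?G \<subseteq> (\<Union>i. S i \<union> T i)" by (rule subsetI)
  have far: "vtx \<gamma> n y y 1 \<in> T True" "vtx \<gamma> n y y (- 1) \<in> T False"
    by (simp_all add: T_def sgn_of_def)
  show ?thesis
    by (rule graph_diameter_eq_3[OF wf_digraph_C_graph cover ST SS ne far
          vtx_opposite_far[OF sp yS yI]])
qed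

text \<open>The disjunction treats \<open>x\<close> and its tilde together. In both cases
  \<open>t'\<close> is \<open>y t\<close> up to sign and \<open>t' y\<close> is \<open>t\<close> up
  to sign, so \<open>t\<close> and \<open>t'\<close> are exactly the first entries for which the
  vertex has a component \<open>\<plusminus>t\<close>.\<close>

lemma diameter_nonsplit:
  fixes \<gamma> :: "nat \<Rightarrow> real" and m :: nat and x y t' :: cd
  defines "n \<equiv> Suc m" and "t \<equiv> Db (cd_zero m) (cd_e m 0)"
  assumes sp: "sign_params \<gamma> n" and m: "m \<ge> 2" and x: "x \<in> cd_basis' m"
    and y: "y = Db x (cd_zero m) \<and> t' = Db (cd_zero m) x \<or>
      y = Db (cd_zero m) x \<and> t' = Db x (cd_zero m)"
    and sq: "cd_mult \<gamma> n y y = cd_scale (\<gamma> n) (cd_e n 0)"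
  shows "graph_diameter (C_graph \<gamma> n y) = 3"
proof -
  let ?G = "C_graph \<gamma> n y"
  define w where "w a \<eta> = Db a (cd_scale \<eta> (cd_mult \<gamma> n a y))" for a \<eta>
  define P where "P = cd_basis' m - {x}"
  define S where "S i = {vtx \<gamma> n y c (sgn_of i) | c p.
    p \<in> P \<and> (c = Db p (cd_zero m) \<or> c = Db (cd_zero m) p)}" for i
  \<comment> \<open>The sign is reversed because \<open>(c, \<beta> c y)\<close> is orthogonal to
    the elements over \<open>t\<close> and \<open>t'\<close> with sign
    \<open>- \<beta>\<close>.\<close>
  define T where "T i = {vtx \<gamma> n y t (- sgn_of i), vtx \<gamma> n y t' (- sgn_of i)}" for i
  have xI: "x \<in> imag_units m" using x cd_basis'_imag_units by auto
  have sm: "sign_params \<gamma> m" "\<bar>\<gamma> m\<bar> = 1" using sp by (simp_all add: n_def sign_params_Suc)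
  have yI: "y \<in> imag_units n" using y xI by (auto simp: n_def imag_units_Suc_iff)
  then have yS: "y \<in> signed_basis n" by simp
  have one: "cd_e m 0 \<in> cd_basis m" by (simp add: cd_basis_def)
  have basis: "t \<in> cd_basis' n" "t' \<in> cd_basis' n"
    using y x one cd_basis'_subset[of m] by (auto simp: t_def n_def cd_basis'_Suc_iff)
  have PI: "p \<in> cd_basis m" "p \<in> imag_units m" "\<not> eq_up_to_sign p x" if "p \<in> P" for p
    using that x eq_up_to_sign_basis[of p m x] cd_basis'_imag_units by (auto simp: P_def cd_basis'_def)
  have pb: "Db p (cd_zero m) \<in> cd_basis' n" "Db (cd_zero m) p \<in> cd_basis' n" if "p \<in> P" for p
    using that PI(1) by (auto simp: P_def n_def cd_basis'_Suc_iff)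
  have orth: "cd_orthogonal \<gamma> (Suc n) (w c \<beta>) (w t (- \<beta>))"
    "cd_orthogonal \<gamma> (Suc n) (w c \<beta>) (w t' (- \<beta>))"
    "cd_orthogonal \<gamma> (Suc n) (w (Db p (cd_zero m)) \<beta>) (w (Db (cd_zero m) p) (- \<beta>))"
    if p: "p \<in> P" and \<beta>: "\<bar>\<beta>\<bar> = 1" and c: "c = Db p (cd_zero m) \<or> c = Db (cd_zero m) p" for p c \<beta>
  proof -
    have "cd_orthogonal \<gamma> (Suc n) (w c \<beta>) (w t (- \<beta>)) \<and>
      cd_orthogonal \<gamma> (Suc n) (w c \<beta>) (w t' (- \<beta>)) \<and>
      cd_orthogonal \<gamma> (Suc n) (w (Db p (cd_zero m)) \<beta>) (w (Db (cd_zero m) p) (- \<beta>))"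
      using y
    proof
      assume y: "y = Db x (cd_zero m) \<and> t' = Db (cd_zero m) x"
      then have "cd_mult \<gamma> m x x = cd_scale (\<gamma> (Suc m)) (cd_e m 0)"
        using sq xI by (simp add: n_def)
      then show ?thesis
        using y orthogonal_even[OF sp[unfolded n_def] xI PI(2,3)[OF p] _ \<beta> c]
        by (simp add: w_def t_def n_def)
    next
      assume y: "y = Db (cd_zero m) x \<and> t' = Db x (cd_zero m)"
      \<comment> \<open>The square of \<open>(0, x)\<close> is \<open>- \<gamma> m\<close> times
        that of \<open>x\<close>; since \<open>\<gamma> m\<close> is a sign, scaling by
        \<open>- \<gamma> m\<close> again isolates the square of \<open>x\<close>.\<close>
      then have "cd_scale (- \<gamma> m) (cd_mult \<gamma> m x x) = cd_scale (\<gamma> (Suc m)) (cd_e m 0)"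
        using sq xI by (simp add: n_def cd_conj_imag_unit)
      from arg_cong[OF this, of "cd_scale (- \<gamma> m)"]
      have "cd_mult \<gamma> m x x = cd_scale (- (\<gamma> m * \<gamma> (Suc m))) (cd_e m 0)"
        using sm(2) by (auto simp: abs_eq_iff')
      then show ?thesis
        using y orthogonal_odd[OF sp[unfolded n_def] xI PI(2,3)[OF p] _ \<beta> c]
        by (simp add: w_def t_def n_def)
    qed
    then show "cd_orthogonal \<gamma> (Suc n) (w c \<beta>) (w t (- \<beta>))"
      "cd_orthogonal \<gamma> (Suc n) (w c \<beta>) (w t' (- \<beta>))"
      "cd_orthogonal \<gamma> (Suc n) (w (Db p (cd_zero m)) \<beta>) (w (Db (cd_zero m) p) (- \<beta>))" by auto
  qed
  have arc: "vtx \<gamma> n y a \<beta> \<rightarrow>\<^bsub>?G\<^esub> vtx \<gamma> n y c (- \<beta>) \<and> vtx \<gamma> n y c (- \<beta>) \<rightarrow>\<^bsub>?G\<^esub> vtx \<gamma> n y a \<beta>"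
    if "a \<in> cd_basis' n" "c \<in> cd_basis' n" "a \<noteq> c" "\<bar>\<beta>\<bar> = 1"
      "cd_orthogonal \<gamma> (Suc n) (w a \<beta>) (w c (- \<beta>))" for a c \<beta>
  proof -
    have "a \<in> imag_units n" "c \<in> imag_units n" "\<not> eq_up_to_sign a c"
      using that eq_up_to_sign_basis[of a n c] cd_basis'_imag_units by (auto simp: cd_basis'_def)
    then show ?thesis
      using C_graph_vtx_arc[OF sp yS, of a c \<beta> "- \<beta>"] that(4,5) by (simp add: w_def)
  qed
  have pne: "p \<noteq> cd_zero m" "p \<noteq> x" "p \<noteq> cd_e m 0" if "p \<in> P" for p
    using that PI(2)[OF that] zero_not_signed_basis[of p m] by (auto simp: P_def cd_basis'_def)
  have ST: "s \<rightarrow>\<^bsub>?G\<^esub> u \<and> u \<rightarrow>\<^bsub>?G\<^esub> s" if s: "s \<in> S i" and u: "u \<in> T i" for i s u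
  proof -
    obtain p c where p: "p \<in> P" and c: "c = Db p (cd_zero m) \<or> c = Db (cd_zero m) p"
      and sc: "s = vtx \<gamma> n y c (sgn_of i)"
      using s by (auto simp: S_def)
    have "c \<in> cd_basis' n" using pb[OF p] c by auto
    moreover have "c \<noteq> t" "c \<noteq> t'" using c pne[OF p] y by (auto simp: t_def)
    ultimately show ?thesis
      using u orth(1,2)[OF p abs_sgn_of c] arc basis sc by (auto simp: T_def)
  qed
  have SS: "\<exists>s' \<in> S (\<not> i). s \<rightarrow>\<^bsub>?G\<^esub> s' \<and> s' \<rightarrow>\<^bsub>?G\<^esub> s" if s: "s \<in> S i" for i s
  proof -
    obtain p c where p: "p \<in> P" and c: "c = Db p (cd_zero m) \<or> c = Db (cd_zero m) p"
      and sc: "s = vtx \<gamma> n y c (sgn_of i)"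
      using s by (auto simp: S_def)
    have ne: "Db p (cd_zero m) \<noteq> Db (cd_zero m) p" using pne[OF p] by simp
    have edge: "vtx \<gamma> n y (Db p (cd_zero m)) \<beta> \<rightarrow>\<^bsub>?G\<^esub> vtx \<gamma> n y (Db (cd_zero m) p) (- \<beta>) \<and>
        vtx \<gamma> n y (Db (cd_zero m) p) (- \<beta>) \<rightarrow>\<^bsub>?G\<^esub> vtx \<gamma> n y (Db p (cd_zero m)) \<beta>"
      if "\<bar>\<beta>\<bar> = 1" for \<beta>
      using arc[OF pb[OF p] ne that] orth(3)[OF p that] by blast
    have mem: "vtx \<gamma> n y (Db p (cd_zero m)) (- sgn_of i) \<in> S (\<not> i)"
      "vtx \<gamma> n y (Db (cd_zero m) p) (- sgn_of i) \<in> S (\<not> i)"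
      using p unfolding S_def by force+
    show ?thesis using c
    proof
      assume "c = Db p (cd_zero m)"
      then show ?thesis using mem(2) edge[of "sgn_of i"] sc by auto
    next
      assume "c = Db (cd_zero m) p"
      \<comment> \<open>The same edge read from its other end, so the sign at \<open>(p, 0)\<close>
        is the negative one.\<close>
      then show ?thesis using mem(1) edge[of "- sgn_of i"] sc by auto
    qed
  qed
  \<comment> \<open>A second imaginary basis element of \<open>A_m\<close> is needed besides
    \<open>x\<close>, hence \<open>m \<ge> 2\<close>.\<close>
  obtain p where "p \<in> P" using cd_basis'_other[OF m, of x] by (auto simp: P_def)
  then have ne: "S i \<noteq> {}" "T i \<noteq> {}" for i by (auto simp: S_def T_def)
  have "v \<in> (\<Union>i. S i \<union> T i)" if v: "v \<in> verts ?G" for v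
  proof -
    obtain a \<beta> where a: "a \<in> cd_basis' n" "\<bar>\<beta>\<bar> = 1" "v = vtx \<gamma> n y a \<beta>"
      "cd_zero_divisor \<gamma> (Suc n) (Db a (cd_scale \<beta> (cd_mult \<gamma> n a y)))"
      using C_graph_verts[OF v sp signed_basis_CD[OF yS]] by blast
    obtain i where i: "\<beta> = sgn_of i" using sgn_of_cases a(2) by blast
    have j: "\<beta> = - sgn_of (\<not> i)" using i by simp
    \<comment> \<open>For \<open>a = y\<close> the second entry would be a sign times the unit, and
      such an element is no zero divisor.\<close>
    have "a \<noteq> y"
    proof
      assume "a = y"
      then have "cd_zero_divisor \<gamma> (Suc n) (Db y (cd_scale (\<beta> * \<gamma> n) (cd_e n 0)))"
        using a(4) sq by simp
      moreover have "\<bar>\<beta> * \<gamma> n\<bar> = 1"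
        using a(2) signed_basis_alt(3)[OF sp yS sq signed_basis_CD[OF yS]] by (simp add: abs_mult)
      ultimately show False using not_zero_divisor[OF sp yI sq] by blast
    qed
    obtain p where p: "p \<in> cd_basis m" "p \<noteq> cd_e m 0 \<and> a = Db p (cd_zero m) \<or> a = Db (cd_zero m) p"
      using a(1) by (auto simp: n_def cd_basis'_def cd_basis_Suc)
    \<comment> \<open>Outside \<open>P\<close> only \<open>p = 1\<close> and \<open>p = x\<close>
      remain. The former gives \<open>t\<close>; the latter gives \<open>y\<close> or
      \<open>t'\<close>, and \<open>y\<close> is excluded.\<close>
    then have "p \<in> P \<or> a = t \<or> a = t'"
      using \<open>a \<noteq> y\<close> y by (auto simp: P_def cd_basis'_def t_def)
    then show ?thesis
    proof
      assume "p \<in> P"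
      then have "v \<in> S i" using p(2) a(3) i unfolding S_def by blast
      then show ?thesis by blast
    next
      assume "a = t \<or> a = t'"
      then have "v \<in> T (\<not> i)" using a(3) j unfolding T_def by blast
      then show ?thesis by blast
    qed
  qed
  then have cover: "verts ?G \<subseteq> (\<Union>i. S i \<union> T i)" by (rule subsetI)
  have far: "vtx \<gamma> n y t 1 \<in> T False" "vtx \<gamma> n y t (- 1) \<in> T True"
    by (simp_all add: T_def sgn_of_def)
  have tI: "t \<in> imag_units n" using basis cd_basis'_imag_units by auto
  show ?thesis
    by (rule graph_diameter_eq_3[OF wf_digraph_C_graph cover ST SS ne far
          vtx_opposite_far[OF sp yS tI]])
qed

theorem corollary4p8:
  fixes n :: nat and \<gamma> :: "nat \<Rightarrow> real" and x :: cd
  assumes "n \<ge> 3"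
    and "\<forall>k \<le> n. \<gamma> k \<in> {1, -1}"
    and "x \<in> cd_basis' (n - 1)"
  shows "graph_diameter (C_graph \<gamma> n (cd_embed (n - 1) x)) = 3 \<and>
         graph_diameter (C_graph \<gamma> n (cd_tilde \<gamma> n (cd_embed (n - 1) x))) = 3"
proof -
  define m where "m = n - 1"
  have n: "n = Suc m" and m: "m \<ge> 2" using assms(1) by (auto simp: m_def)
  have x: "x \<in> cd_basis' m" using assms(3) by (simp add: m_def)
  have xCD: "x \<in> CD m" using x cd_basis_subset_CD by (auto simp: cd_basis'_def)
  have sp: "sign_params \<gamma> n"
    unfolding sign_params_def
  proof (intro allI impI)
    fix k assume "k < n"
    then have "\<gamma> k \<in> {1, - 1}" using assms(2) by simp
    then show "\<bar>\<gamma> k\<bar> = 1" by auto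
  qed
  have \<gamma>: "\<gamma> n = 1 \<or> \<gamma> n = - 1" using assms(2) by auto
  have diameter: "graph_diameter (C_graph \<gamma> n y) = 3"
    if y: "y = Db x (cd_zero m) \<and> t' = Db (cd_zero m) x \<or>
      y = Db (cd_zero m) x \<and> t' = Db x (cd_zero m)" for y t'
  proof -
    have yb: "y \<in> cd_basis' n"
      using y x cd_basis'_subset[of m] by (auto simp: n cd_basis'_Suc_iff)
    then have "y \<in> signed_basis n" by (simp add: cd_basis'_def signed_basis_def)
    then obtain c where c: "\<bar>c\<bar> = 1" "cd_mult \<gamma> n y y = cd_scale c (cd_e n 0)"
      by (rule signed_basis_square[OF sp])
    \<comment> \<open>Both \<open>c\<close> and \<open>\<gamma> n\<close> are signs, so the two
      diameter lemmas exhaust all cases.\<close>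
    have "c = - \<gamma> n \<or> c = \<gamma> n" using c(1) \<gamma> by linarith
    then show ?thesis
    proof
      assume "c = - \<gamma> n"
      then show ?thesis using diameter_split[OF sp _ yb] c m n by simp
    next
      assume "c = \<gamma> n"
      then show ?thesis using diameter_nonsplit[OF sp[unfolded n] m x y] c n by simp
    qed
  qed
  have "cd_embed (n - 1) x = Db x (cd_zero m)" by (simp add: cd_embed_def m_def)
  \<comment> \<open>By the product rule \<open>(x, 0) (0, 1) = (0, x)\<close>, so the tilde lands on
    the second copy of \<open>x\<close> without a sign.\<close>
  moreover have "cd_tilde \<gamma> n (cd_embed (n - 1) x) = Db (cd_zero m) x"
    using xCD by (simp add: cd_tilde_def cd_embed_def n)
  ultimately show ?thesis using diameter by metis
qed

end
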